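(* Let $X,Y,A,B$ be non-empty finite sets. Then $\mathcal O^{\mathcal R_{\rm loc}}_{XY,AB}=\mathcal S_1^{A,X}\otimes_{w,{\rm cb}}\mathcal S_1^{B,Y}$ up to a complete isometry (under the identification $\epsilon_{(x,y),(a,b)}\leftrightarrow\epsilon_{x,a}\otimes\epsilon_{y,b}$).
   Context: $\mathcal S_1^{A,X}$ is the space of operators $\mathbb C^A\to\mathbb C^X$ (matrix units $\epsilon_{x,a}=e_xe_a^*$), with the operator space structure making $(\mathcal S_1^{A,X})^*=M_{A,X}$ via $\langle S,T\rangle={\rm Tr}(ST)$ a complete isometry; similarly $\mathcal S_1^{B,Y}$, and $\mathcal S_1^{AB,XY}$ (with $XY=X\times Y$, $AB=A\times B$) is identified with $\mathcal S_1^{A,X}\otimes\mathcal S_1^{B,Y}$. For a block operator isometry $W=(W_{(a,b),(x,y)})$ over $(XY,AB)$ with entries in $\mathcal B(H,K)$, $\phi_W:\mathcal S_1^{AB,XY}\to\mathcal B(H,K)$ is linear with $\phi_W(\epsilon_{(x,y),(a,b)})=W_{(a,b),(x,y)}$. An isometry $U:\mathbb C^X\to\mathbb C^A\otimes\mathbb C^S$ ($S$ finite) has entries $U_{a,x}\in\mathcal B(\mathbb C,\mathbb C^S)$ with $Ue_x=\sum_ae_a\otimes U_{a,x}$; likewise $V:\mathbb C^Y\to\mathbb C^B\otimes\mathbb C^T$; $U\otimes V$ has entries $U_{a,x}\otimes V_{b,y}$. $\mathcal R_{\rm loc}$ is the set of all finite (entrywise) direct sums of such $U\otimes V$. $\mathcal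 O^{\mathcal R_{\rm loc}}_{XY,AB}$ is $\mathcal S_1^{AB,XY}$ with matricial norms $\|u\|^{(n)}=\sup_{W\in\mathcal R_{\rm loc}}\|\phi^{(n)}_W(u)\|$. Let $R=(\ell_2)_r$, $C=(\ell_2)_c$ be row and column Hilbert operator spaces. An element $\omega\in M_n(\mathcal S_1^{A,X}\otimes\mathcal S_1^{B,Y})$ is regarded as a linear map $\omega:M_{A,X}\to M_n(\mathcal S_1^{B,Y})$ via the duality above, and $\|\omega\|^{(n)}_{w,{\rm cb}}=\sup\|\beta^{(n)}\circ\omega\circ\alpha\|_{\rm cb}$, the supremum over all complete contractions $\alpha:R\to M_{A,X}$ and $\beta:\mathcal S_1^{B,Y}\to C$; $\mathcal S_1^{A,X}\otimes_{w,{\rm cb}}\mathcal S_1^{B,Y}$ denotes $\mathcal S_1^{A,X}\otimes\mathcal S_1^{B,Y}$ with these matricial norms. *)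

theory Defs
  imports Complex_Main
begin

definition l2n :: "'i set \<Rightarrow> ('i \<Rightarrow> complex) \<Rightarrow> real" where
  "l2n I v = sqrt (\<Sum>i\<in>I. (cmod (v i))^2)"

definition opn :: "'i set \<Rightarrow> 'j set \<Rightarrow> ('i \<Rightarrow> 'j \<Rightarrow> complex) \<Rightarrow> real" where
  "opn I J M = Sup ((\<lambda>v. l2n I (\<lambda>i. \<Sum>j\<in>J. M i j * v j)) ` {v. l2n J v \<le> 1})"

definition ell2 :: "(nat \<Rightarrow> complex) set" where
  "ell2 = {f. summable (\<lambda>k. (cmod (f k))^2)}"

definition ell2sq :: "(nat \<Rightarrow> complex) \<Rightarrow> real" where
  "ell2sq f = (\<Sum>k. (cmod (f k))^2)"

text \<open>Norm in M_{I,J}(R), R the row Hilbert space: the matrix r of l2-elements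
  (row vectors) is the operator from the direct sum over J of l2 to C^I.\<close>
definition rown :: "'i set \<Rightarrow> 'j set \<Rightarrow> ('i \<Rightarrow> 'j \<Rightarrow> nat \<Rightarrow> complex) \<Rightarrow> real" where
  "rown I J r = Sup ((\<lambda>\<eta>. sqrt (\<Sum>i\<in>I. (cmod (\<Sum>j\<in>J. \<Sum>k. r i j k * \<eta> j k))^2))
        ` {\<eta>. (\<forall>j\<in>J. \<eta> j \<in> ell2) \<and> (\<Sum>j\<in>J. ell2sq (\<eta> j)) \<le> 1})"

text \<open>Norm in M_{I,J}(C), C the column Hilbert space: the matrix c of l2-elements
  (column vectors) is the operator from C^J to the direct sum over I of l2.\<close>
definition coln :: "'i set \<Rightarrow> 'j set \<Rightarrow> ('i \<Rightarrow> 'j \<Rightarrow> nat \<Rightarrow> complex) \<Rightarrow> real" where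
  "coln I J c = Sup ((\<lambda>z. sqrt (\<Sum>i\<in>I. \<Sum>k. (cmod (\<Sum>j\<in>J. c i j k * z j))^2))
        ` {z. l2n J z \<le> 1})"

text \<open>An element T of M_{A,X} is an operator C^X -> C^A with entries T a x.
  Norm in M_m(M_{A,X}) (block matrix indices p,q < m).\<close>
definition mnormM :: "nat \<Rightarrow> (nat \<Rightarrow> nat \<Rightarrow> 'a::finite \<Rightarrow> 'x::finite \<Rightarrow> complex) \<Rightarrow> real" where
  "mnormM m T = opn ({..<m} \<times> UNIV) ({..<m} \<times> UNIV) (\<lambda>(p,a) (q,x). T p q a x)"

text \<open>An element S of S_1^{B,Y} is an operator C^B -> C^Y with entries S y b.
  The operator space structure is the one making S_1^{B,Y} the dual of M_{B,Y}
  (pairing Tr(ST)): M_m(S_1^{B,Y}) = CB(M_{B,Y}, M_m), i.e. the norm of s is the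
  cb norm of T |-> (Tr(s_{pq} T))_{p,q}.\<close>
definition s1n :: "nat \<Rightarrow> (nat \<Rightarrow> nat \<Rightarrow> 'y::finite \<Rightarrow> 'b::finite \<Rightarrow> complex) \<Rightarrow> real" where
  "s1n m s = Sup {opn ({..<k} \<times> {..<m}) ({..<k} \<times> {..<m})
                    (\<lambda>(i,p) (j,q). \<Sum>y\<in>UNIV. \<Sum>b\<in>UNIV. s p q y b * T i j b y)
                 | k (T :: nat \<Rightarrow> nat \<Rightarrow> 'b \<Rightarrow> 'y \<Rightarrow> complex).
                   0 < k \<and> opn ({..<k} \<times> UNIV) ({..<k} \<times> UNIV) (\<lambda>(i,b) (j,y). T i j b y) \<le> 1}"

definition row_cc :: "((nat \<Rightarrow> complex) \<Rightarrow> 'a::finite \<Rightarrow> 'x::finite \<Rightarrow> complex) \<Rightarrow> bool" where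
  "row_cc \<alpha> \<longleftrightarrow>
     (\<forall>f g. f \<in> ell2 \<longrightarrow> g \<in> ell2 \<longrightarrow> \<alpha> (\<lambda>k. f k + g k) = (\<lambda>a x. \<alpha> f a x + \<alpha> g a x)) \<and>
     (\<forall>c f. f \<in> ell2 \<longrightarrow> \<alpha> (\<lambda>k. c * f k) = (\<lambda>a x. c * \<alpha> f a x)) \<and>
     (\<forall>m r. 0 < m \<and> (\<forall>p<m. \<forall>q<m. r p q \<in> ell2) \<and> rown {..<m} {..<m} r \<le> 1
        \<longrightarrow> mnormM m (\<lambda>p q. \<alpha> (r p q)) \<le> 1)"

definition col_cc :: "(('y::finite \<Rightarrow> 'b::finite \<Rightarrow> complex) \<Rightarrow> nat \<Rightarrow> complex) \<Rightarrow> bool" where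
  "col_cc \<beta> \<longleftrightarrow>
     (\<forall>S S'. \<beta> (\<lambda>y b. S y b + S' y b) = (\<lambda>k. \<beta> S k + \<beta> S' k)) \<and>
     (\<forall>c S. \<beta> (\<lambda>y b. c * S y b) = (\<lambda>k. c * \<beta> S k)) \<and>
     (\<forall>S. \<beta> S \<in> ell2) \<and>
     (\<forall>m s. 0 < m \<and> s1n m s \<le> 1 \<longrightarrow> coln {..<m} {..<m} (\<lambda>p q. \<beta> (s p q)) \<le> 1)"

text \<open>u p q (x,y) (a,b) is the coefficient of the (p,q) entry of an element of
  M_n(S_1^{A,X} (x) S_1^{B,Y}) at eps_{x,a} (x) eps_{y,b} (equivalently, of an element
  of M_n(S_1^{AB,XY}) at eps_{(x,y),(a,b)}).  As a map M_{A,X} -> M_n(S_1^{B,Y}):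
  T |-> entries  (y,b) |-> sum_{x,a} u p q (x,y) (a,b) * Tr(eps_{x,a} T),
  and Tr(eps_{x,a} T) = T a x.\<close>
definition omega_map ::
  "(nat \<Rightarrow> nat \<Rightarrow> ('x::finite \<times> 'y::finite) \<Rightarrow> ('a::finite \<times> 'b::finite) \<Rightarrow> complex)
   \<Rightarrow> ('a \<Rightarrow> 'x \<Rightarrow> complex) \<Rightarrow> nat \<Rightarrow> nat \<Rightarrow> 'y \<Rightarrow> 'b \<Rightarrow> complex" where
  "omega_map u T = (\<lambda>p q y b. \<Sum>x\<in>UNIV. \<Sum>a\<in>UNIV. u p q (x,y) (a,b) * T a x)"

text \<open>cb norm of a map Phi : R -> M_n(C); M_m(M_n(C)) = M_{mn}(C).\<close>
definition cbn_RC :: "nat \<Rightarrow> ((nat \<Rightarrow> complex) \<Rightarrow> nat \<Rightarrow> nat \<Rightarrow> nat \<Rightarrow> complex) \<Rightarrow> real" where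
  "cbn_RC n \<Phi> = Sup {coln ({..<m} \<times> {..<n}) ({..<m} \<times> {..<n}) (\<lambda>(i,p) (j,q). \<Phi> (r i j) p q)
                     | m (r :: nat \<Rightarrow> nat \<Rightarrow> nat \<Rightarrow> complex). 0 < m \<and> (\<forall>i<m. \<forall>j<m. r i j \<in> ell2) \<and> rown {..<m} {..<m} r \<le> 1}"

definition wcb_norm ::
  "nat \<Rightarrow> (nat \<Rightarrow> nat \<Rightarrow> ('x::finite \<times> 'y::finite) \<Rightarrow> ('a::finite \<times> 'b::finite) \<Rightarrow> complex) \<Rightarrow> real" where
  "wcb_norm n u = Sup {cbn_RC n (\<lambda>\<xi> p q. \<beta> (omega_map u (\<alpha> \<xi>) p q))
                       | (\<alpha> :: (nat \<Rightarrow> complex) \<Rightarrow> 'a \<Rightarrow> 'x \<Rightarrow> complex)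
                         (\<beta> :: ('y \<Rightarrow> 'b \<Rightarrow> complex) \<Rightarrow> nat \<Rightarrow> complex).
                         row_cc \<alpha> \<and> col_cc \<beta>}"

text \<open>Isometry U : C^X -> C^A (x) C^S with S = {..<s}; U a x sigma is the sigma-th
  coordinate of U_{a,x} in C^S.\<close>
definition iso_ent :: "nat \<Rightarrow> ('a::finite \<Rightarrow> 'x::finite \<Rightarrow> nat \<Rightarrow> complex) \<Rightarrow> bool" where
  "iso_ent s U \<longleftrightarrow>
     (\<forall>x x'. (\<Sum>a\<in>UNIV. \<Sum>\<sigma><s. cnj (U a x \<sigma>) * U a x' \<sigma>) = (if x = x' then 1 else 0))"

text \<open>A finite direct sum of U_i (x) V_i is encoded by the list of (s_i, U_i, t_i, V_i).
  Then H = C^k (k = length), K = direct sum of C^{S_i} (x) C^{T_i}, with basis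
  indexed by Kset.\<close>
type_synonym ('a,'b,'x,'y) loc_data =
  "(nat \<times> ('a \<Rightarrow> 'x \<Rightarrow> nat \<Rightarrow> complex) \<times> nat \<times> ('b \<Rightarrow> 'y \<Rightarrow> nat \<Rightarrow> complex)) list"

definition Kset :: "('a,'b,'x,'y) loc_data \<Rightarrow> (nat \<times> nat \<times> nat) set" where
  "Kset Ws = {(i,\<sigma>,\<tau>). i < length Ws \<and> \<sigma> < fst (Ws!i) \<and> \<tau> < fst (snd (snd (Ws!i)))}"

definition Wentry :: "('a,'b,'x,'y) loc_data \<Rightarrow> ('a \<times> 'b) \<Rightarrow> ('x \<times> 'y) \<Rightarrow> (nat \<times> nat \<times> nat) \<Rightarrow> nat \<Rightarrow> complex" where
  "Wentry Ws ab xy = (\<lambda>(i,\<sigma>,\<tau>) j. if i = j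
      then fst (snd (Ws!i)) (fst ab) (fst xy) \<sigma> * snd (snd (snd (Ws!i))) (snd ab) (snd xy) \<tau>
      else 0)"

definition Rloc :: "('a::finite,'b::finite,'x::finite,'y::finite) loc_data set" where
  "Rloc = {Ws. Ws \<noteq> [] \<and> (\<forall>i<length Ws. iso_ent (fst (Ws!i)) (fst (snd (Ws!i)))
                                      \<and> iso_ent (fst (snd (snd (Ws!i)))) (snd (snd (snd (Ws!i)))))}"

definition phiW_norm :: "nat \<Rightarrow> ('a::finite,'b::finite,'x::finite,'y::finite) loc_data
     \<Rightarrow> (nat \<Rightarrow> nat \<Rightarrow> ('x \<times> 'y) \<Rightarrow> ('a \<times> 'b) \<Rightarrow> complex) \<Rightarrow> real" where
  "phiW_norm n Ws u = opn ({..<n} \<times> Kset Ws) ({..<n} \<times> {..<length Ws})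
      (\<lambda>(p,\<kappa>) (q,j). \<Sum>xy\<in>UNIV. \<Sum>ab\<in>UNIV. u p q xy ab * Wentry Ws ab xy \<kappa> j)"

definition loc_norm ::
  "nat \<Rightarrow> (nat \<Rightarrow> nat \<Rightarrow> ('x::finite \<times> 'y::finite) \<Rightarrow> ('a::finite \<times> 'b::finite) \<Rightarrow> complex) \<Rightarrow> real" where
  "loc_norm n u = Sup {phiW_norm n Ws u | Ws :: ('a,'b,'x,'y) loc_data. Ws \<in> Rloc}"

end

theory Submission
  imports Defs "HOL-Analysis.Convex"
begin

text \<open>
  By the duality of row and column Hilbert space, a complete contraction \<open>R \<rightarrow> M\<^sub>A\<^sub>,\<^sub>X\<close> is the same thing as
  a contraction \<open>U : \<complex>\<^sup>X \<rightarrow> \<complex>\<^sup>A \<otimes> \<ell>\<^sub>2\<close>, a complete contraction \<open>S\<^sub>1\<^sup>B\<^sup>,\<^sup>Y \<rightarrow> C\<close> is a contraction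
  \<open>V : \<complex>\<^sup>Y \<rightarrow> \<complex>\<^sup>B \<otimes> \<ell>\<^sub>2\<close>, and the cb norm of the composition \<open>R \<rightarrow> M\<^sub>n(C)\<close> is the norm of the column
  operator \<open>\<Sum> u \<cdot> (U \<otimes> V)\<close>. Only finitely many vectors of \<open>\<ell>\<^sub>2\<close> occur in each inequality, so by
  Gram-Schmidt \<open>\<ell>\<^sub>2\<close> may be replaced by some \<open>\<complex>\<^sup>s\<close>. A contraction into \<open>\<complex>\<^sup>A \<otimes> \<complex>\<^sup>s\<close> is a
  corner of an isometry into \<open>\<complex>\<^sup>A \<otimes> \<complex>\<^sup>s\<^sup>'\<close> for some \<open>s' \<ge> s\<close>, and dropping
  coordinates does not increase the norm. Hence both norms have the same upper bounds, namely those valid for all pairs of isometries (a direct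
  sum contributes the maximum over its summands).
\<close>

subsection \<open>Norms given by suprema over unit balls\<close>

text \<open>All norms here are real suprema, and \<open>Sup\<close> of an empty or unbounded set of
  reals carries no information. They are therefore handled through criteria that turn a bound on a
  norm into a quadratic inequality, and each criterion rests on a non-empty test set and an a priori
  bound. For the two final norms this bound must not depend on the ancilla sizes: it comes from the
  fact that a contraction on C^X has squared Hilbert-Schmidt norm at most |X|. The duality of row
  and column space enters as Bessel's inequality: a column of orthonormal vectors of the row space
  is a contraction. Since the row norm uses a bilinear pairing, the conjugated family appears next
  to it. A second obstacle is the shape of the tests. Complete contractivity is stated for square
  matrices labelled by initial segments of nat, while the natural tests are a column and a matrix
  with rows in B and columns in Y; these are relabelled and padded by zeros.\<close>

abbreviation sq :: "complex \<Rightarrow> real" where "sq z \<equiv> (cmod z)\<^sup>2"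

lemma sq_sum_mult_le:
  "sq (\<Sum>i\<in>I. a i * b i) \<le> (\<Sum>i\<in>I. sq (a i)) * (\<Sum>i\<in>I. sq (b i))"
proof -
  have "cmod (\<Sum>i\<in>I. a i * b i) \<le> (\<Sum>i\<in>I. cmod (a i) * cmod (b i))"
    by (rule order_trans[OF norm_sum]) (simp add: norm_mult)
  then have "sq (\<Sum>i\<in>I. a i * b i) \<le> (\<Sum>i\<in>I. cmod (a i) * cmod (b i))\<^sup>2"
    by (rule power_mono) simp
  also have "\<dots> \<le> (\<Sum>i\<in>I. sq (a i)) * (\<Sum>i\<in>I. sq (b i))"
    by (rule Cauchy_Schwarz_ineq_sum)
  finally show ?thesis .
qed

text \<open>On the kernel of \<open>N\<close> all multiples of a vector lie in the unit ball, which forces \<open>Q\<close> to vanish there.\<close>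

lemma Sup_sqrt_ratio:
  fixes N Q :: "'v \<Rightarrow> real" and sc :: "real \<Rightarrow> 'v \<Rightarrow> 'v"
  assumes N0: "\<And>v. v \<in> D \<Longrightarrow> 0 \<le> N v" and Q0: "\<And>v. v \<in> D \<Longrightarrow> 0 \<le> Q v"
    and Nsc: "\<And>c v. v \<in> D \<Longrightarrow> N (sc c v) = c\<^sup>2 * N v"
    and Qsc: "\<And>c v. v \<in> D \<Longrightarrow> Q (sc c v) = c\<^sup>2 * Q v"
    and scD: "\<And>c v. v \<in> D \<Longrightarrow> sc c v \<in> D"
    and bdd: "\<And>v. v \<in> D \<Longrightarrow> N v \<le> 1 \<Longrightarrow> Q v \<le> K"
    and ne: "D \<noteq> {}"
  shows "0 \<le> Sup ((\<lambda>v. sqrt (Q v)) ` {v \<in> D. N v \<le> 1}) \<and>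
    (\<forall>L\<ge>0. Sup ((\<lambda>v. sqrt (Q v)) ` {v \<in> D. N v \<le> 1}) \<le> L \<longleftrightarrow> (\<forall>v\<in>D. Q v \<le> L\<^sup>2 * N v))"
proof (intro conjI allI impI)
  from ne obtain v0 where v0: "v0 \<in> D" by blast
  \<comment> \<open>Scaling by 0 yields a point of the unit ball although the abstract type offers
    no zero vector.\<close>
  then have mem: "sc 0 v0 \<in> {v \<in> D. N v \<le> 1}" using Nsc[of v0 0] scD by simp
  then have ne': "(\<lambda>v. sqrt (Q v)) ` {v \<in> D. N v \<le> 1} \<noteq> {}" by blast
  have bdd': "bdd_above ((\<lambda>v. sqrt (Q v)) ` {v \<in> D. N v \<le> 1})"
    using bdd by (intro bdd_aboveI2[where M = "sqrt K"]) simp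
  have "0 \<le> sqrt (Q (sc 0 v0))" using Q0 scD v0 by simp
  also have "\<dots> \<le> Sup ((\<lambda>v. sqrt (Q v)) ` {v \<in> D. N v \<le> 1})"
    using mem bdd' by (intro cSup_upper) auto
  finally show "0 \<le> Sup ((\<lambda>v. sqrt (Q v)) ` {v \<in> D. N v \<le> 1})" .
  fix L :: real assume L: "0 \<le> L"
  from bdd' have "Sup ((\<lambda>v. sqrt (Q v)) ` {v \<in> D. N v \<le> 1}) \<le> L
      \<longleftrightarrow> (\<forall>v\<in>D. N v \<le> 1 \<longrightarrow> sqrt (Q v) \<le> L)"
    using cSup_le_iff[OF ne'] by auto
  also have "\<dots> \<longleftrightarrow> (\<forall>v\<in>D. N v \<le> 1 \<longrightarrow> Q v \<le> L\<^sup>2)"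
    using L Q0 by (metis abs_of_nonneg real_sqrt_abs real_sqrt_le_iff)
  also have "\<dots> \<longleftrightarrow> (\<forall>v\<in>D. Q v \<le> L\<^sup>2 * N v)"
  proof (intro iffI ballI impI)
    fix v assume *: "\<forall>v\<in>D. N v \<le> 1 \<longrightarrow> Q v \<le> L\<^sup>2" and v: "v \<in> D"
    show "Q v \<le> L\<^sup>2 * N v"
    proof (cases "N v = 0")
      case True
      have "Q v \<le> 0"
      proof (rule ccontr)
        assume "\<not> Q v \<le> 0"
        then have pos: "0 < Q v" by simp
        \<comment> \<open>This factor brings the value of \<open>Q\<close> to
          \<open>L\<^sup>2 + 1\<close>, above the assumed bound.\<close>
        define c where "c = sqrt ((L\<^sup>2 + 1) / Q v)"
        have c2: "c\<^sup>2 = (L\<^sup>2 + 1) / Q v" using pos unfolding c_def by simp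
        have "Q (sc c v) \<le> L\<^sup>2" using * scD[OF v] Nsc[OF v] True by simp
        then show False using Qsc[OF v, of c] c2 pos by simp
      qed
      then show ?thesis using True by simp
    next
      case False
      then have pos: "0 < N v" using N0[OF v] by simp
      define c where "c = sqrt (1 / N v)"
      have c2: "c\<^sup>2 = 1 / N v" using pos unfolding c_def by simp
      have "Q (sc c v) \<le> L\<^sup>2" using * scD[OF v] Nsc[OF v, of c] c2 pos by simp
      then show ?thesis using Qsc[OF v, of c] c2 pos by (simp add: field_simps)
    qed
  next
    fix v assume *: "\<forall>v\<in>D. Q v \<le> L\<^sup>2 * N v" and v: "v \<in> D" and "N v \<le> 1"
    then show "Q v \<le> L\<^sup>2" using mult_left_mono[of "N v" 1 "L\<^sup>2"] by force
  qed
  finally show "Sup ((\<lambda>v. sqrt (Q v)) ` {v \<in> D. N v \<le> 1}) \<le> L \<longleftrightarrow> (\<forall>v\<in>D. Q v \<le> L\<^sup>2 * N v)" .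
qed

text \<open>The squared Hilbert-Schmidt norm, by Cauchy-Schwarz, is the finite bound that
  \<open>Sup_sqrt_ratio\<close> asks for.\<close>

lemma
  assumes "finite I" "finite J"
  shows opn_nonneg: "0 \<le> opn I J M"
    and opn_le_iff: "0 \<le> L \<Longrightarrow> opn I J M \<le> L \<longleftrightarrow>
      (\<forall>v. (\<Sum>i\<in>I. sq (\<Sum>j\<in>J. M i j * v j)) \<le> L\<^sup>2 * (\<Sum>j\<in>J. sq (v j)))"
      (is "_ \<Longrightarrow> ?iff")
proof -
  define Q where "Q v = (\<Sum>i\<in>I. sq (\<Sum>j\<in>J. M i j * v j))" for v
  define N where "N v = (\<Sum>j\<in>J. sq (v j))" for v :: "'b \<Rightarrow> complex"
  have eq: "opn I J M = Sup ((\<lambda>v. sqrt (Q v)) ` {v \<in> UNIV. N v \<le> 1})"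
    unfolding opn_def l2n_def Q_def N_def by simp
  have "0 \<le> Sup ((\<lambda>v. sqrt (Q v)) ` {v \<in> UNIV. N v \<le> 1}) \<and>
    (\<forall>L\<ge>0. Sup ((\<lambda>v. sqrt (Q v)) ` {v \<in> UNIV. N v \<le> 1}) \<le> L \<longleftrightarrow> (\<forall>v\<in>UNIV. Q v \<le> L\<^sup>2 * N v))"
  proof (rule Sup_sqrt_ratio[where sc = "\<lambda>c v j. complex_of_real c * v j"
        and K = "\<Sum>i\<in>I. \<Sum>j\<in>J. sq (M i j)"])
    show "Q (\<lambda>j. complex_of_real c * v j) = c\<^sup>2 * Q v" for c v
    proof -
      have "(\<Sum>j\<in>J. M i j * (complex_of_real c * v j)) = complex_of_real c * (\<Sum>j\<in>J. M i j * v j)" for i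
        by (simp add: sum_distrib_left mult.left_commute)
      then have "sq (\<Sum>j\<in>J. M i j * (complex_of_real c * v j)) = c\<^sup>2 * sq (\<Sum>j\<in>J. M i j * v j)" if "i \<in> I" for i
        using that by (simp only: norm_mult power_mult_distrib norm_of_real power2_abs)
      then show ?thesis unfolding Q_def sum_distrib_left by (intro sum.cong refl)
    qed
    show "N (\<lambda>j. complex_of_real c * v j) = c\<^sup>2 * N v" for c v
      unfolding N_def by (simp add: norm_mult power_mult_distrib sum_distrib_left)
    show "Q v \<le> (\<Sum>i\<in>I. \<Sum>j\<in>J. sq (M i j))" if "N v \<le> 1" for v
      unfolding Q_def
    proof (rule sum_mono)
      fix i
      have "sq (\<Sum>j\<in>J. M i j * v j) \<le> (\<Sum>j\<in>J. sq (M i j)) * N v"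
        unfolding N_def by (rule sq_sum_mult_le)
      also have "\<dots> \<le> (\<Sum>j\<in>J. sq (M i j)) * 1"
        using that by (intro mult_left_mono sum_nonneg) auto
      finally show "sq (\<Sum>j\<in>J. M i j * v j) \<le> (\<Sum>j\<in>J. sq (M i j))" by simp
    qed
  qed (auto simp: Q_def N_def intro!: sum_nonneg)
  from this[folded eq] show "0 \<le> opn I J M" "0 \<le> L \<Longrightarrow> ?iff"
    unfolding Q_def N_def by auto
qed

section \<open>Square-summable sequences and the row and column norms\<close>

lemma ell2_zero: "(\<lambda>k. 0) \<in> ell2"
  by (simp add: ell2_def)

lemma ell2_scale: "f \<in> ell2 \<Longrightarrow> (\<lambda>k. c * f k) \<in> ell2"
  by (simp add: ell2_def norm_mult power_mult_distrib summable_mult)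

lemma ell2_cnj: "f \<in> ell2 \<Longrightarrow> (\<lambda>k. cnj (f k)) \<in> ell2"
  by (simp add: ell2_def)

lemma mult_le_sum_squares: "a * b \<le> a\<^sup>2 + b\<^sup>2" for a b :: real
  using sum_squares_bound[of a b] zero_le_power2[of a] zero_le_power2[of b] by linarith

lemma ell2_summable_norm_mult:
  assumes "f \<in> ell2" "g \<in> ell2"
  shows "summable (\<lambda>k. cmod (f k * g k))"
proof (rule summable_comparison_test)
  show "summable (\<lambda>k. sq (f k) + sq (g k))"
    using assms unfolding ell2_def by (auto intro: summable_add)
  show "\<exists>M. \<forall>k\<ge>M. norm (cmod (f k * g k)) \<le> sq (f k) + sq (g k)"
    by (simp add: norm_mult mult_le_sum_squares)
qed

lemma ell2_summable_mult:
  "f \<in> ell2 \<Longrightarrow> g \<in> ell2 \<Longrightarrow> summable (\<lambda>k. f k * g k)"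
  by (rule summable_norm_cancel) (rule ell2_summable_norm_mult)

lemma ell2_add:
  assumes "f \<in> ell2" "g \<in> ell2"
  shows "(\<lambda>k. f k + g k) \<in> ell2"
proof -
  have "sq (f k + g k) \<le> 2 * sq (f k) + 2 * sq (g k)" for k
  proof -
    have "sq (f k + g k) \<le> (cmod (f k) + cmod (g k))\<^sup>2"
      by (rule power_mono) (auto simp: norm_triangle_ineq)
    also have "\<dots> \<le> 2 * sq (f k) + 2 * sq (g k)"
      using zero_le_power2[of "cmod (f k) - cmod (g k)"] by (simp add: power2_diff power2_sum)
    finally show ?thesis .
  qed
  then have "\<exists>M. \<forall>k\<ge>M. norm (sq (f k + g k)) \<le> 2 * sq (f k) + 2 * sq (g k)" by simp
  moreover have "summable (\<lambda>k. 2 * sq (f k) + 2 * sq (g k))"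
    using assms unfolding ell2_def by (auto intro!: summable_add summable_mult)
  ultimately have "summable (\<lambda>k. sq (f k + g k))" by (rule summable_comparison_test)
  then show ?thesis by (simp add: ell2_def)
qed

lemma ell2_sum:
  assumes "\<And>i. i \<in> I \<Longrightarrow> f i \<in> ell2"
  shows "(\<lambda>k. \<Sum>i\<in>I. f i k) \<in> ell2"
  using assms by (induction I rule: infinite_finite_induct) (auto simp: ell2_zero ell2_add)

lemma ell2_finite_support:
  assumes "\<And>k. k \<ge> N \<Longrightarrow> f k = 0"
  shows "f \<in> ell2" "ell2sq f = (\<Sum>k<N. sq (f k))"
proof -
  have "(\<lambda>k. sq (f k)) sums (\<Sum>k<N. sq (f k))"
    using assms by (intro sums_finite) auto
  then show "f \<in> ell2" "ell2sq f = (\<Sum>k<N. sq (f k))"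
    by (auto simp: ell2_def ell2sq_def sums_iff)
qed

lemma ell2sq_nonneg: "f \<in> ell2 \<Longrightarrow> 0 \<le> ell2sq f"
  by (simp add: ell2_def ell2sq_def suminf_nonneg)

lemma ell2sq_scale: "f \<in> ell2 \<Longrightarrow> ell2sq (\<lambda>k. c * f k) = sq c * ell2sq f"
  by (simp add: ell2_def ell2sq_def norm_mult power_mult_distrib suminf_mult)

lemma ell2sq_eq_0D: "f \<in> ell2 \<Longrightarrow> ell2sq f = 0 \<Longrightarrow> f k = 0"
  using suminf_eq_zero_iff[of "\<lambda>k. sq (f k)"] by (auto simp: ell2_def ell2sq_def)

text \<open>A sum in place of the sharp product is enough, since the estimate only has to show that
  the supremum in \<open>rown\<close> is taken over a bounded set.\<close>

lemma cmod_suminf_mult_le: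
  assumes "f \<in> ell2" "g \<in> ell2"
  shows "cmod (\<Sum>k. f k * g k) \<le> ell2sq f + ell2sq g"
proof -
  have "cmod (\<Sum>k. f k * g k) \<le> (\<Sum>k. cmod (f k * g k))"
    by (rule summable_norm[OF ell2_summable_norm_mult[OF assms]])
  also have "\<dots> \<le> (\<Sum>k. sq (f k) + sq (g k))"
  proof (rule suminf_le)
    show "cmod (f k * g k) \<le> sq (f k) + sq (g k)" for k
      by (simp add: norm_mult mult_le_sum_squares)
    show "summable (\<lambda>k. cmod (f k * g k))" by (rule ell2_summable_norm_mult[OF assms])
    show "summable (\<lambda>k. sq (f k) + sq (g k))"
      using assms unfolding ell2_def by (auto intro: summable_add)
  qed
  also have "\<dots> = ell2sq f + ell2sq g"
    using assms unfolding ell2_def ell2sq_def by (auto intro: suminf_add[symmetric])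
  finally show ?thesis .
qed

text \<open>On the unit ball \<open>cmod_suminf_mult_le\<close> bounds the \<open>i\<close>-th
  coordinate by \<open>(\<Sum>j\<in>J. ell2sq (r i j)) + 1\<close>; the bound \<open>K\<close> sums
  the squares of these numbers.\<close>

lemma
  assumes fin: "finite I" "finite J"
    and r: "\<And>i j. i \<in> I \<Longrightarrow> j \<in> J \<Longrightarrow> r i j \<in> ell2"
  shows rown_le_iff: "0 \<le> L \<Longrightarrow> rown I J r \<le> L \<longleftrightarrow> (\<forall>\<eta>. (\<forall>j\<in>J. \<eta> j \<in> ell2) \<longrightarrow>
    (\<Sum>i\<in>I. sq (\<Sum>j\<in>J. \<Sum>k. r i j k * \<eta> j k)) \<le> L\<^sup>2 * (\<Sum>j\<in>J. ell2sq (\<eta> j)))"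
      (is "_ \<Longrightarrow> ?iff")
proof -
  define D where "D = {\<eta> :: 'b \<Rightarrow> nat \<Rightarrow> complex. \<forall>j\<in>J. \<eta> j \<in> ell2}"
  define Q where "Q \<eta> = (\<Sum>i\<in>I. sq (\<Sum>j\<in>J. \<Sum>k. r i j k * \<eta> j k))" for \<eta>
  define N where "N \<eta> = (\<Sum>j\<in>J. ell2sq (\<eta> j))" for \<eta> :: "'b \<Rightarrow> nat \<Rightarrow> complex"
  have eq: "rown I J r = Sup ((\<lambda>v. sqrt (Q v)) ` {v \<in> D. N v \<le> 1})"
    unfolding rown_def Q_def N_def D_def by simp
  have "0 \<le> Sup ((\<lambda>v. sqrt (Q v)) ` {v \<in> D. N v \<le> 1}) \<and>
    (\<forall>L\<ge>0. Sup ((\<lambda>v. sqrt (Q v)) ` {v \<in> D. N v \<le> 1}) \<le> L \<longleftrightarrow> (\<forall>v\<in>D. Q v \<le> L\<^sup>2 * N v))"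
  proof (rule Sup_sqrt_ratio[where sc = "\<lambda>c v j k. complex_of_real c * v j k"
        and K = "\<Sum>i\<in>I. ((\<Sum>j\<in>J. ell2sq (r i j)) + 1)\<^sup>2"])
    fix v assume v: "v \<in> D"
    show "(\<lambda>j k. complex_of_real c * v j k) \<in> D" for c
      using v by (auto simp: D_def ell2_scale)
    show "Q (\<lambda>j k. complex_of_real c * v j k) = c\<^sup>2 * Q v" for c
    proof -
      have "(\<Sum>j\<in>J. \<Sum>k. r i j k * (complex_of_real c * v j k))
          = complex_of_real c * (\<Sum>j\<in>J. \<Sum>k. r i j k * v j k)" if "i \<in> I" for i
        unfolding sum_distrib_left
      proof (rule sum.cong)
        fix j assume "j \<in> J"
        then have "summable (\<lambda>k. r i j k * v j k)"
          using v r that by (intro ell2_summable_mult) (auto simp: D_def)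
        from suminf_mult[OF this, of "complex_of_real c"]
        show "(\<Sum>k. r i j k * (complex_of_real c * v j k)) = complex_of_real c * (\<Sum>k. r i j k * v j k)"
          by (simp add: mult.left_commute)
      qed simp
      then have "sq (\<Sum>j\<in>J. \<Sum>k. r i j k * (complex_of_real c * v j k)) = c\<^sup>2 * sq (\<Sum>j\<in>J. \<Sum>k. r i j k * v j k)" if "i \<in> I" for i
        using that by (simp only: norm_mult power_mult_distrib norm_of_real power2_abs)
      then show ?thesis unfolding Q_def sum_distrib_left by (intro sum.cong refl)
    qed
    show "N (\<lambda>j k. complex_of_real c * v j k) = c\<^sup>2 * N v" for c
      using v unfolding N_def D_def by (simp add: ell2sq_scale sum_distrib_left)
    show "0 \<le> N v" using v unfolding N_def D_def by (auto intro!: sum_nonneg ell2sq_nonneg)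
    show "Q v \<le> (\<Sum>i\<in>I. ((\<Sum>j\<in>J. ell2sq (r i j)) + 1)\<^sup>2)" if "N v \<le> 1"
      unfolding Q_def
    proof (rule sum_mono)
      fix i assume i: "i \<in> I"
      have "cmod (\<Sum>j\<in>J. \<Sum>k. r i j k * v j k) \<le> (\<Sum>j\<in>J. ell2sq (r i j) + ell2sq (v j))"
        using v r[OF i] by (intro sum_norm_le cmod_suminf_mult_le) (auto simp: D_def)
      also have "\<dots> \<le> (\<Sum>j\<in>J. ell2sq (r i j)) + 1"
        using that by (simp add: sum.distrib N_def)
      finally show "sq (\<Sum>j\<in>J. \<Sum>k. r i j k * v j k) \<le> ((\<Sum>j\<in>J. ell2sq (r i j)) + 1)\<^sup>2"
        by (rule power_mono) simp
    qed
  next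
    have "(\<lambda>_ _. 0) \<in> D" by (simp add: D_def ell2_zero)
    then show "D \<noteq> {}" by blast
  qed (auto simp: Q_def intro!: sum_nonneg)
  from this[folded eq] show "0 \<le> L \<Longrightarrow> ?iff"
    unfolding Q_def N_def D_def by simp_all
qed

text \<open>Cauchy-Schwarz is applied at each \<open>k\<close> and then summed over
  \<open>k\<close>, so a Hilbert-Schmidt bound again makes the supremum proper.\<close>

lemma
  assumes fin: "finite I" "finite J"
    and c: "\<And>i j. i \<in> I \<Longrightarrow> j \<in> J \<Longrightarrow> c i j \<in> ell2"
  shows coln_nonneg: "0 \<le> coln I J c"
    and coln_le_iff: "0 \<le> L \<Longrightarrow> coln I J c \<le> L \<longleftrightarrow>
    (\<forall>z. (\<Sum>i\<in>I. ell2sq (\<lambda>k. \<Sum>j\<in>J. c i j k * z j)) \<le> L\<^sup>2 * (\<Sum>j\<in>J. sq (z j)))"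
      (is "_ \<Longrightarrow> ?iff")
proof -
  define Q where "Q z = (\<Sum>i\<in>I. ell2sq (\<lambda>k. \<Sum>j\<in>J. c i j k * z j))" for z
  define N where "N v = (\<Sum>j\<in>J. sq (v j))" for v :: "'b \<Rightarrow> complex"
  have mem: "(\<lambda>k. \<Sum>j\<in>J. c i j k * z j) \<in> ell2" if "i \<in> I" for i z
  proof -
    have "(\<lambda>k. \<Sum>j\<in>J. z j * c i j k) \<in> ell2"
      using c[OF that] by (intro ell2_sum ell2_scale) auto
    then show ?thesis by (simp add: mult.commute)
  qed
  have eq: "coln I J c = Sup ((\<lambda>v. sqrt (Q v)) ` {v \<in> UNIV. N v \<le> 1})"
    unfolding coln_def l2n_def Q_def N_def ell2sq_def by simp
  have "0 \<le> Sup ((\<lambda>v. sqrt (Q v)) ` {v \<in> UNIV. N v \<le> 1}) \<and>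
    (\<forall>L\<ge>0. Sup ((\<lambda>v. sqrt (Q v)) ` {v \<in> UNIV. N v \<le> 1}) \<le> L \<longleftrightarrow> (\<forall>v\<in>UNIV. Q v \<le> L\<^sup>2 * N v))"
  proof (rule Sup_sqrt_ratio[where sc = "\<lambda>c v j. complex_of_real c * v j"
        and K = "\<Sum>i\<in>I. \<Sum>j\<in>J. ell2sq (c i j)"])
    show "0 \<le> Q v" for v using mem unfolding Q_def by (auto intro!: sum_nonneg ell2sq_nonneg)
    show "Q (\<lambda>j. complex_of_real a * v j) = a\<^sup>2 * Q v" for a v
      unfolding Q_def sum_distrib_left
    proof (rule sum.cong)
      fix i assume "i \<in> I"
      have "(\<lambda>k. \<Sum>j\<in>J. c i j k * (complex_of_real a * v j))
          = (\<lambda>k. complex_of_real a * (\<Sum>j\<in>J. c i j k * v j))"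
        by (simp add: sum_distrib_left mult.left_commute)
      then show "ell2sq (\<lambda>k. \<Sum>j\<in>J. c i j k * (complex_of_real a * v j))
          = a\<^sup>2 * ell2sq (\<lambda>k. \<Sum>j\<in>J. c i j k * v j)"
        using mem[OF \<open>i \<in> I\<close>] by (simp add: ell2sq_scale)
    qed simp
    show "N (\<lambda>j. complex_of_real c * v j) = c\<^sup>2 * N v" for c v
      unfolding N_def by (simp add: norm_mult power_mult_distrib sum_distrib_left)
    show "Q v \<le> (\<Sum>i\<in>I. \<Sum>j\<in>J. ell2sq (c i j))" if "N v \<le> 1" for v
      unfolding Q_def
    proof (rule sum_mono)
      fix i assume i: "i \<in> I"
      have *: "summable (\<lambda>k. sq (c i j k))" if "j \<in> J" for j
        using c[OF i that] by (simp add: ell2_def)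
      have "sq (\<Sum>j\<in>J. c i j k * v j) \<le> (\<Sum>j\<in>J. sq (c i j k))" for k
      proof -
        have "sq (\<Sum>j\<in>J. c i j k * v j) \<le> (\<Sum>j\<in>J. sq (c i j k)) * N v"
          unfolding N_def by (rule sq_sum_mult_le)
        also have "\<dots> \<le> (\<Sum>j\<in>J. sq (c i j k)) * 1"
          using that by (intro mult_left_mono sum_nonneg) auto
        finally show ?thesis by simp
      qed
      then have "ell2sq (\<lambda>k. \<Sum>j\<in>J. c i j k * v j) \<le> (\<Sum>k. \<Sum>j\<in>J. sq (c i j k))"
        using mem[OF i] * unfolding ell2sq_def ell2_def
        by (intro suminf_le) (auto intro!: summable_sum)
      also have "\<dots> = (\<Sum>j\<in>J. ell2sq (c i j))"
        unfolding ell2sq_def using * by (rule suminf_sum)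
      finally show "ell2sq (\<lambda>k. \<Sum>j\<in>J. c i j k * v j) \<le> (\<Sum>j\<in>J. ell2sq (c i j))" .
    qed
  qed (auto simp: N_def intro!: sum_nonneg)
  from this[folded eq] show "0 \<le> coln I J c" "0 \<le> L \<Longrightarrow> ?iff"
    unfolding Q_def N_def by auto
qed

subsection \<open>Contractions and isometries\<close>

lemma cnj_mult_self: "cnj z * z = complex_of_real (sq z)"
  by (simp add: complex_norm_square mult.commute del: of_real_power)

text \<open>Cholesky factorisation, one index at a time: the new index \<open>x\<close> is the
  pivot, and the remaining form on the old indices is a Schur complement.\<close>

lemma psd_gram:
  fixes G :: "'i \<Rightarrow> 'i \<Rightarrow> complex"
  assumes "finite I" "\<And>i j. i \<in> I \<Longrightarrow> j \<in> I \<Longrightarrow> G j i = cnj (G i j)"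
    "\<And>v. 0 \<le> Re (\<Sum>i\<in>I. \<Sum>j\<in>I. cnj (v i) * G i j * v j)"
  shows "\<exists>d D. \<forall>i\<in>I. \<forall>j\<in>I. G i j = (\<Sum>l<d::nat. cnj (D i l) * D j l)"
  using assms
proof (induction arbitrary: G rule: finite_induct)
  case (insert x F)
  note herm = insert.prems(1) and psd = insert.prems(2)
  define b where "b v = (\<Sum>j\<in>F. G x j * v j)" for v
  define H where "H v = (\<Sum>i\<in>F. \<Sum>j\<in>F. cnj (v i) * G i j * v j)" for v
  define g where "g = Re (G x x)"
  have "G x x = cnj (G x x)" by (intro herm) simp_all
  then have Gxx: "G x x = complex_of_real g" by (simp add: g_def complex_eq_iff)
  have Gx: "G i x = cnj (G x i)" if "i \<in> F" for i using that by (intro herm) simp_all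
  \<comment> \<open>The form at \<open>v\<close> with its coordinate at \<open>x\<close> set to
    \<open>t\<close>; both cases exploit the freedom in \<open>t\<close>.\<close>
  have star: "0 \<le> sq t * g + 2 * Re (cnj t * b v) + Re (H v)" for t v
  proof -
    define w where "w = v(x := t)"
    have w: "w x = t" "\<And>i. i \<in> F \<Longrightarrow> w i = v i" using insert.hyps by (auto simp: w_def)
    have "(\<Sum>i\<in>F. cnj (v i) * G i x) = cnj (b v)"
      unfolding b_def cnj_sum by (intro sum.cong) (auto simp: Gx)
    moreover have "(\<Sum>i\<in>insert x F. \<Sum>j\<in>insert x F. cnj (w i) * G i j * w j)
      = cnj t * G x x * t + cnj t * b v + (\<Sum>i\<in>F. cnj (v i) * G i x) * t + H v"
      using insert.hyps unfolding b_def H_def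
      by (simp add: w sum.distrib sum_distrib_left sum_distrib_right mult.assoc cong: sum.cong_simp)
    ultimately have "(\<Sum>i\<in>insert x F. \<Sum>j\<in>insert x F. cnj (w i) * G i j * w j)
      = complex_of_real (sq t * g) + (cnj t * b v + cnj (cnj t * b v)) + H v"
      by (simp add: Gxx complex_norm_square algebra_simps flip: of_real_power)
    with psd[of w] show ?thesis by (simp add: complex_add_cnj del: complex_cnj_mult)
  qed
  have g0: "0 \<le> g" using star[of 1 "\<lambda>_. 0"] by (simp add: b_def H_def)
  show ?case
  proof (cases "g = 0")
    case True
    \<comment> \<open>With a zero pivot the part quadratic in \<open>t\<close> is absent, so a
      non-zero linear part could be made arbitrarily negative.\<close>
    have z: "G x j = 0" if j: "j \<in> F" for j
    proof (rule ccontr)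
      assume "G x j \<noteq> 0"
      then have pos: "0 < sq (G x j)" by simp
      let ?v = "\<lambda>i. if i = j then 1 else 0 :: complex"
      have bv: "b ?v = G x j" unfolding b_def using j insert.hyps(1)
        by (simp add: if_distrib cong: if_cong)
      \<comment> \<open>With this \<open>s\<close> the right-hand side of \<open>star\<close> is
        -1.\<close>
      define s where "s = (Re (H ?v) + 1) / (2 * sq (G x j))"
      have "Re (cnj (- complex_of_real s * G x j) * G x j) = - s * sq (G x j)"
        using arg_cong[OF cnj_mult_self[of "G x j"], of "\<lambda>z. Re (- complex_of_real s * z)"]
        by (simp add: mult.assoc del: of_real_power)
      with star[of "- complex_of_real s * G x j" ?v] True
      have "0 \<le> 2 * (- s * sq (G x j)) + Re (H ?v)" unfolding bv by simp
      moreover have "s * sq (G x j) = (Re (H ?v) + 1) / 2" using pos by (simp add: s_def)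
      ultimately show False by simp
    qed
    have "0 \<le> Re (\<Sum>i\<in>F. \<Sum>j\<in>F. cnj (v i) * G i j * v j)" for v
      using star[of 0 v] by (simp add: H_def)
    moreover have "G j i = cnj (G i j)" if "i \<in> F" "j \<in> F" for i j
      using that by (intro herm) auto
    ultimately obtain d D where D: "\<forall>i\<in>F. \<forall>j\<in>F. G i j = (\<Sum>l<d::nat. cnj (D i l) * D j l)"
      using insert.IH[of G] by blast
    have z': "G j x = 0" if "j \<in> F" for j using z[OF that] Gx[OF that] by simp
    show ?thesis
      using D z z' Gxx True insert.hyps(2)
      by (intro exI[of _ d] exI[of _ "D(x := \<lambda>_. 0)"]) auto
  next
    case False
    with g0 have g: "0 < g" by simp
    \<comment> \<open>The Schur complement of the pivot. Its positivity is \<open>star\<close> at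
      the minimiser \<open>t = - b v / g\<close>.\<close>
    define G' where "G' i j = G i j - cnj (G x i) * G x j / g" for i j
    have "0 \<le> Re (\<Sum>i\<in>F. \<Sum>j\<in>F. cnj (v i) * G' i j * v j)" for v
    proof -
      have "(\<Sum>i\<in>F. \<Sum>j\<in>F. cnj (v i) * G' i j * v j) = H v - cnj (b v) * b v / g"
        unfolding G'_def H_def b_def cnj_sum sum_product sum_divide_distrib
        by (simp add: algebra_simps sum_subtractf)
      also have "cnj (b v) * b v / g = complex_of_real (sq (b v) / g)"
        by (simp add: complex_norm_square mult.commute flip: of_real_power)
      finally have e: "Re (\<Sum>i\<in>F. \<Sum>j\<in>F. cnj (v i) * G' i j * v j) = Re (H v) - sq (b v) / g"
        by simp
      have t: "Re (cnj (- b v / g) * b v) = - sq (b v) / g"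
        using arg_cong[OF cnj_mult_self[of "b v"], of "\<lambda>z. Re (- z / g)"]
        by (simp del: of_real_power)
      have "sq (- b v / g) * g = sq (b v) / g"
        using g by (simp add: norm_divide power_divide power2_eq_square)
      with star[of "- b v / g" v] show ?thesis unfolding e t by simp
    qed
    moreover have "G' j i = cnj (G' i j)" if "i \<in> F" "j \<in> F" for i j
      using herm[of i j] that by (simp add: G'_def)
    ultimately obtain d D where D: "\<forall>i\<in>F. \<forall>j\<in>F. G' i j = (\<Sum>l<d::nat. cnj (D i l) * D j l)"
      using insert.IH[of G'] by blast
    have D: "G i j = (\<Sum>l<d. cnj (D i l) * D j l) + cnj (G x i) * G x j / g" if "i \<in> F" "j \<in> F" for i j
      using D that unfolding G'_def by (metis diff_eq_eq)
    \<comment> \<open>The extra coordinate \<open>d\<close> holds the pivot row divided by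
      \<open>sqrt g\<close> and so restores the subtracted rank-one term. The vector of
      \<open>x\<close> lives in this coordinate alone.\<close>
    define D' where "D' i l = (if l < d then (if i = x then 0 else D i l) else G x i / sqrt g)" for i l
    have sg: "complex_of_real (sqrt g) * complex_of_real (sqrt g) = g"
      using g by (simp flip: of_real_mult)
    have e: "(\<Sum>l<Suc d. cnj (D' i l) * D' j l)
      = (if i = x \<or> j = x then 0 else \<Sum>l<d. cnj (D i l) * D j l) + cnj (G x i) * G x j / g" for i j
      by (simp add: D'_def sg)
    have xF: "i \<noteq> x" if "i \<in> F" for i using that insert.hyps by auto
    have "G i j = (\<Sum>l<Suc d. cnj (D' i l) * D' j l)" if ij: "i \<in> insert x F" "j \<in> insert x F" for i j
    proof -
      consider "i = x" "j = x" | "i = x" "j \<in> F" | "i \<in> F" "j = x" | "i \<in> F" "j \<in> F"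
        using ij by blast
      then show ?thesis
      proof cases
        case 4
        then show ?thesis unfolding e using xF[of i] xF[of j] D[of i j] by simp
      qed (unfold e, use g in \<open>simp_all add: Gxx Gx\<close>)
    qed
    then show ?thesis by blast
  qed
qed simp

section \<open>Dilating a contraction to an isometry\<close>

definition contr :: "nat \<Rightarrow> ('a::finite \<Rightarrow> 'x::finite \<Rightarrow> nat \<Rightarrow> complex) \<Rightarrow> bool" where
  "contr s U \<longleftrightarrow>
    (\<forall>v. (\<Sum>a\<in>UNIV. \<Sum>\<sigma><s. sq (\<Sum>x\<in>UNIV. U a x \<sigma> * v x)) \<le> (\<Sum>x\<in>UNIV. sq (v x)))"

text \<open>Writes the squared norm of the image through the Gram matrix \<open>U\<^sup>*U\<close>,
  in terms of which both isometry and the defect of a contraction are expressed.\<close>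

lemma gram_form:
  fixes U :: "'a::finite \<Rightarrow> 'x::finite \<Rightarrow> nat \<Rightarrow> complex"
  shows "complex_of_real (\<Sum>a\<in>UNIV. \<Sum>\<sigma><s. sq (\<Sum>x\<in>UNIV. U a x \<sigma> * v x))
    = (\<Sum>x\<in>UNIV. \<Sum>x'\<in>UNIV. cnj (v x) * (\<Sum>a\<in>UNIV. \<Sum>\<sigma><s. cnj (U a x \<sigma>) * U a x' \<sigma>) * v x')"
proof -
  \<comment> \<open>The two output indices become one, so that each exchange with an input sum is a
    single \<open>sum.swap\<close>.\<close>
  let ?P = "UNIV \<times> {..<s} :: ('a \<times> nat) set"
  define f where "f p x x' = cnj (v x) * (cnj (U (fst p) x (snd p)) * U (fst p) x' (snd p)) * v x'"
    for p x x'
  have P: "(\<Sum>p\<in>?P. h p) = (\<Sum>a\<in>UNIV. \<Sum>\<sigma><s. h (a, \<sigma>))" for h :: "'a \<times> nat \<Rightarrow> complex"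
    by (simp add: sum.cartesian_product)
  have "complex_of_real (\<Sum>a\<in>UNIV. \<Sum>\<sigma><s. sq (\<Sum>x\<in>UNIV. U a x \<sigma> * v x))
    = (\<Sum>a\<in>UNIV. \<Sum>\<sigma><s. cnj (\<Sum>x\<in>UNIV. U a x \<sigma> * v x) * (\<Sum>x\<in>UNIV. U a x \<sigma> * v x))"
    by (simp add: complex_norm_square mult.commute del: of_real_power cnj_sum)
  also have "\<dots> = (\<Sum>a\<in>UNIV. \<Sum>\<sigma><s. \<Sum>x\<in>UNIV. \<Sum>x'\<in>UNIV. f (a, \<sigma>) x x')"
    unfolding cnj_sum sum_product f_def by (intro sum.cong refl) simp
  also have "\<dots> = (\<Sum>p\<in>?P. \<Sum>x\<in>UNIV. \<Sum>x'\<in>UNIV. f p x x')"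
    by (rule P[symmetric])
  also have "\<dots> = (\<Sum>x\<in>UNIV. \<Sum>p\<in>?P. \<Sum>x'\<in>UNIV. f p x x')" by (rule sum.swap)
  also have "\<dots> = (\<Sum>x\<in>UNIV. \<Sum>x'\<in>UNIV. \<Sum>p\<in>?P. f p x x')"
    by (intro sum.cong refl sum.swap)
  also have "\<dots> = (\<Sum>x\<in>UNIV. \<Sum>x'\<in>UNIV. cnj (v x) * (\<Sum>a\<in>UNIV. \<Sum>\<sigma><s. cnj (U a x \<sigma>) * U a x' \<sigma>) * v x')"
    unfolding P by (simp add: f_def sum_distrib_left sum_distrib_right)
  finally show ?thesis .
qed

lemma delta_form:
  fixes v :: "'x::finite \<Rightarrow> complex"
  shows "(\<Sum>x\<in>UNIV. \<Sum>x'\<in>UNIV. cnj (v x) * (if x = x' then 1 else 0) * v x')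
    = complex_of_real (\<Sum>x\<in>UNIV. sq (v x))"
  by (simp add: complex_norm_square mult.commute if_distrib if_distribR del: of_real_power cong: if_cong)

lemma iso_ent_imp_contr:
  assumes "iso_ent s U"
  shows "contr s U"
  unfolding contr_def
proof
  fix v
  have "complex_of_real (\<Sum>a\<in>UNIV. \<Sum>\<sigma><s. sq (\<Sum>x\<in>UNIV. U a x \<sigma> * v x))
    = complex_of_real (\<Sum>x\<in>UNIV. sq (v x))"
    using assms unfolding gram_form iso_ent_def by (simp only: delta_form)
  then show "(\<Sum>a\<in>UNIV. \<Sum>\<sigma><s. sq (\<Sum>x\<in>UNIV. U a x \<sigma> * v x)) \<le> (\<Sum>x\<in>UNIV. sq (v x))"
    by (simp only: of_real_eq_iff)
qed

lemma sum_lessThan_add: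
  "(\<Sum>\<sigma><s + d. f \<sigma>) = (\<Sum>\<sigma><s. f \<sigma>) + (\<Sum>l<d. f (s + l))"
  for f :: "nat \<Rightarrow> 'c::comm_monoid_add"
  by (induction d) (auto simp: add.assoc)

text \<open>The defect \<open>1 - U\<^sup>*U\<close> is a Gram matrix, whose vectors are stored in new coordinates
  of one fixed block \<open>a0\<close>.\<close>

lemma contr_extends_to_iso:
  fixes U :: "'a::finite \<Rightarrow> 'x::finite \<Rightarrow> nat \<Rightarrow> complex"
  assumes "contr s U"
  shows "\<exists>s' U'. s \<le> s' \<and> iso_ent s' U' \<and> (\<forall>a x. \<forall>\<sigma><s. U' a x \<sigma> = U a x \<sigma>)"
proof -
  define K where "K x x' = (\<Sum>a\<in>UNIV. \<Sum>\<sigma><s. cnj (U a x \<sigma>) * U a x' \<sigma>)" for x x'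
  define G where "G x x' = (if x = x' then 1 else 0) - K x x'" for x x'
  have herm: "G x' x = cnj (G x x')" for x x'
    unfolding G_def K_def by (simp add: mult.commute)
  have psd: "0 \<le> Re (\<Sum>x\<in>UNIV. \<Sum>x'\<in>UNIV. cnj (v x) * G x x' * v x')" for v
  proof -
    have "(\<Sum>x\<in>UNIV. \<Sum>x'\<in>UNIV. cnj (v x) * G x x' * v x')
      = complex_of_real (\<Sum>x\<in>UNIV. sq (v x))
        - complex_of_real (\<Sum>a\<in>UNIV. \<Sum>\<sigma><s. sq (\<Sum>x\<in>UNIV. U a x \<sigma> * v x))"
      unfolding gram_form delta_form[symmetric] sum_subtractf[symmetric] G_def K_def
      by (intro sum.cong refl) (simp add: left_diff_distrib right_diff_distrib)
    then show ?thesis using assms by (simp add: contr_def)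
  qed
  have "\<exists>d D. \<forall>x\<in>UNIV. \<forall>x'\<in>UNIV. G x x' = (\<Sum>l<d::nat. cnj (D x l) * D x' l)"
    by (rule psd_gram[OF finite_UNIV herm psd])
  then obtain d D where D: "\<forall>x x'. G x x' = (\<Sum>l<d::nat. cnj (D x l) * D x' l)" by blast
  \<comment> \<open>Any block will do; one exists because every type is inhabited.\<close>
  define a0 where "a0 = (undefined :: 'a)"
  define U' where "U' a x \<sigma> = (if \<sigma> < s then U a x \<sigma> else if a = a0 then D x (\<sigma> - s) else 0)" for a x \<sigma>
  have "(\<Sum>a\<in>UNIV. \<Sum>\<sigma><s + d. cnj (U' a x \<sigma>) * U' a x' \<sigma>) = K x x' + G x x'" for x x'
  proof -
    have "(\<Sum>a\<in>UNIV. \<Sum>l<d. cnj (U' a x (s + l)) * U' a x' (s + l))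
       = (\<Sum>a\<in>UNIV. if a = a0 then G x x' else 0)"
      using D by (intro sum.cong) (auto simp: U'_def)
    then show ?thesis
      by (simp add: sum_lessThan_add sum.distrib) (simp add: U'_def K_def)
  qed
  then have "iso_ent (s + d) U'" unfolding iso_ent_def by (simp add: G_def)
  moreover have "\<forall>a x. \<forall>\<sigma><s. U' a x \<sigma> = U a x \<sigma>" by (simp add: U'_def)
  ultimately show ?thesis by (meson le_add1)
qed

text \<open>Each of the |X| basis vectors is sent to a vector of norm at most 1. What matters is
  that the bound is free of \<open>s\<close>.\<close>

lemma contr_entries_le:
  fixes U :: "'a::finite \<Rightarrow> 'x::finite \<Rightarrow> nat \<Rightarrow> complex"
  assumes "contr s U"
  shows "(\<Sum>\<sigma><s. \<Sum>x\<in>UNIV. \<Sum>a\<in>UNIV. sq (U a x \<sigma>)) \<le> real (card (UNIV :: 'x set))"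
proof -
  have "(\<Sum>a\<in>UNIV. \<Sum>\<sigma><s. sq (U a x \<sigma>)) \<le> 1" for x
    using assms[unfolded contr_def, rule_format, of "\<lambda>x'. if x' = x then 1 else 0"]
    by (simp add: if_distrib if_distribR cong: if_cong)
  then have "(\<Sum>x\<in>UNIV. \<Sum>a\<in>UNIV. \<Sum>\<sigma><s. sq (U a x \<sigma>)) \<le> (\<Sum>x::'x\<in>UNIV. 1)"
    by (intro sum_mono)
  also have "(\<Sum>x\<in>UNIV. \<Sum>a\<in>UNIV. \<Sum>\<sigma><s. sq (U a x \<sigma>)) = (\<Sum>x\<in>UNIV. \<Sum>\<sigma><s. \<Sum>a\<in>UNIV. sq (U a x \<sigma>))"
    by (intro sum.cong refl sum.swap)
  also have "\<dots> = (\<Sum>\<sigma><s. \<Sum>x\<in>UNIV. \<Sum>a\<in>UNIV. sq (U a x \<sigma>))" by (rule sum.swap)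
  finally show ?thesis by simp
qed

section \<open>Bounds valid for all pairs of local isometries\<close>

definition wsum ::
  "(nat \<Rightarrow> nat \<Rightarrow> ('x::finite \<times> 'y::finite) \<Rightarrow> ('a::finite \<times> 'b::finite) \<Rightarrow> complex)
   \<Rightarrow> ('a \<Rightarrow> 'x \<Rightarrow> nat \<Rightarrow> complex) \<Rightarrow> ('b \<Rightarrow> 'y \<Rightarrow> nat \<Rightarrow> complex)
   \<Rightarrow> nat \<Rightarrow> nat \<Rightarrow> nat \<Rightarrow> nat \<Rightarrow> complex" where
  "wsum u U V p q \<sigma> \<tau> = (\<Sum>xy\<in>UNIV. \<Sum>ab\<in>UNIV.
     u p q xy ab * (U (fst ab) (fst xy) \<sigma> * V (snd ab) (snd xy) \<tau>))"

text \<open>The numbers \<open>wsum\<close> are the coordinates of the image of \<open>u\<close>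
  under the map attached to U tensor V. They form an operator from C^n to C^n tensor C^s tensor C^t,
  and for \<open>0 \<le> L\<close> the condition says that its norm is at most \<open>L\<close>.
  Isometry is a separate condition so that contractions fit as well.\<close>

definition bnd ::
  "nat \<Rightarrow> (nat \<Rightarrow> nat \<Rightarrow> ('x::finite \<times> 'y::finite) \<Rightarrow> ('a::finite \<times> 'b::finite) \<Rightarrow> complex)
   \<Rightarrow> real \<Rightarrow> nat \<Rightarrow> ('a \<Rightarrow> 'x \<Rightarrow> nat \<Rightarrow> complex) \<Rightarrow> nat \<Rightarrow> ('b \<Rightarrow> 'y \<Rightarrow> nat \<Rightarrow> complex) \<Rightarrow> bool" where
  "bnd n u L s U t V \<longleftrightarrow> (\<forall>z. (\<Sum>p<n. \<Sum>\<sigma><s. \<Sum>\<tau><t. sq (\<Sum>q<n. wsum u U V p q \<sigma> \<tau> * z q))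
     \<le> L\<^sup>2 * (\<Sum>q<n. sq (z q)))"

definition iso_bnd ::
  "nat \<Rightarrow> (nat \<Rightarrow> nat \<Rightarrow> ('x::finite \<times> 'y::finite) \<Rightarrow> ('a::finite \<times> 'b::finite) \<Rightarrow> complex)
   \<Rightarrow> real \<Rightarrow> bool" where
  "iso_bnd n u L \<longleftrightarrow> (\<forall>s U t V. iso_ent s U \<longrightarrow> iso_ent t V \<longrightarrow> bnd n u L s U t V)"

lemma sum_UNIV_prod: "(\<Sum>xy\<in>UNIV. f xy) = (\<Sum>x\<in>UNIV. \<Sum>y\<in>UNIV. f (x, y))"
  for f :: "'x::finite \<times> 'y::finite \<Rightarrow> 'c::comm_monoid_add"
  by (simp add: sum.cartesian_product flip: UNIV_Times_UNIV)

text \<open>Supplies the boundedness of both final suprema. Cauchy-Schwarz separates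
  \<open>u\<close> from U tensor V, whose squared Hilbert-Schmidt norm factors and is controlled by
  \<open>contr_entries_le\<close>.\<close>

lemma iso_bnd_exists: "\<exists>L\<ge>0. iso_bnd n u L"
  for u :: "nat \<Rightarrow> nat \<Rightarrow> ('x::finite \<times> 'y::finite) \<Rightarrow> ('a::finite \<times> 'b::finite) \<Rightarrow> complex"
proof -
  define c where "c p q = (\<Sum>xy\<in>UNIV. \<Sum>ab\<in>UNIV. sq (u p q xy ab))" for p q
  define K where "K = (\<Sum>p<n. \<Sum>q<n. c p q) * (real (card (UNIV :: 'x set)) * real (card (UNIV :: 'y set)))"
  have c0: "0 \<le> c p q" for p q unfolding c_def by (intro sum_nonneg) auto
  have K0: "0 \<le> K" unfolding K_def using c0 by (intro mult_nonneg_nonneg sum_nonneg) auto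
  have "bnd n u (sqrt K) s U t V" if "iso_ent s U" "iso_ent t V"
    for s t and U :: "'a \<Rightarrow> 'x \<Rightarrow> nat \<Rightarrow> complex" and V :: "'b \<Rightarrow> 'y \<Rightarrow> nat \<Rightarrow> complex"
    unfolding bnd_def
  proof
    fix z :: "nat \<Rightarrow> complex"
    define Nz where "Nz = (\<Sum>q<n. sq (z q))"
    define e where "e \<sigma> = (\<Sum>x\<in>UNIV. \<Sum>a\<in>UNIV. sq (U a x \<sigma>))" for \<sigma>
    define f where "f \<tau> = (\<Sum>y\<in>UNIV. \<Sum>b\<in>UNIV. sq (V b y \<tau>))" for \<tau>
    have Nz0: "0 \<le> Nz" unfolding Nz_def by (intro sum_nonneg) auto
    have w: "sq (wsum u U V p q \<sigma> \<tau>) \<le> c p q * (e \<sigma> * f \<tau>)" for p q \<sigma> \<tau>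
    proof -
      let ?UV = "\<lambda>xy ab. U (fst ab) (fst xy) \<sigma> * V (snd ab) (snd xy) \<tau>"
      have "sq (wsum u U V p q \<sigma> \<tau>) \<le> c p q * (\<Sum>xy\<in>UNIV. \<Sum>ab\<in>UNIV. sq (?UV xy ab))"
        unfolding wsum_def c_def sum.cartesian_product case_prod_unfold by (rule sq_sum_mult_le)
      also have "(\<Sum>xy\<in>UNIV. \<Sum>ab\<in>UNIV. sq (?UV xy ab)) = e \<sigma> * f \<tau>"
        unfolding e_def f_def sum_UNIV_prod sum_product
        by (simp add: norm_mult power_mult_distrib)
      finally show ?thesis .
    qed
    have "(\<Sum>p<n. \<Sum>\<sigma><s. \<Sum>\<tau><t. sq (\<Sum>q<n. wsum u U V p q \<sigma> \<tau> * z q))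
      \<le> (\<Sum>p<n. \<Sum>\<sigma><s. \<Sum>\<tau><t. (\<Sum>q<n. c p q) * Nz * (e \<sigma> * f \<tau>))"
    proof (intro sum_mono)
      fix p \<sigma> \<tau>
      have "sq (\<Sum>q<n. wsum u U V p q \<sigma> \<tau> * z q) \<le> (\<Sum>q<n. sq (wsum u U V p q \<sigma> \<tau>)) * Nz"
        unfolding Nz_def by (rule sq_sum_mult_le)
      also have "\<dots> \<le> (\<Sum>q<n. c p q * (e \<sigma> * f \<tau>)) * Nz"
        using Nz0 w by (intro mult_right_mono sum_mono)
      also have "\<dots> = (\<Sum>q<n. c p q) * Nz * (e \<sigma> * f \<tau>)"
        unfolding sum_distrib_right[symmetric] by (simp only: mult_ac)
      finally show "sq (\<Sum>q<n. wsum u U V p q \<sigma> \<tau> * z q) \<le> (\<Sum>q<n. c p q) * Nz * (e \<sigma> * f \<tau>)" .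
    qed
    also have "\<dots> = (\<Sum>p<n. \<Sum>q<n. c p q) * Nz * ((\<Sum>\<sigma><s. e \<sigma>) * (\<Sum>\<tau><t. f \<tau>))"
      by (simp only: sum_distrib_left[symmetric] sum_distrib_right[symmetric])
    also have "\<dots> \<le> (\<Sum>p<n. \<Sum>q<n. c p q) * Nz * (real (card (UNIV :: 'x set)) * real (card (UNIV :: 'y set)))"
      using that c0 Nz0 unfolding e_def f_def
      by (intro mult_left_mono mult_mono contr_entries_le iso_ent_imp_contr mult_nonneg_nonneg sum_nonneg) auto
    finally show "(\<Sum>p<n. \<Sum>\<sigma><s. \<Sum>\<tau><t. sq (\<Sum>q<n. wsum u U V p q \<sigma> \<tau> * z q)) \<le> (sqrt K)\<^sup>2 * (\<Sum>q<n. sq (z q))"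
      using K0 by (simp add: K_def Nz_def mult_ac)
  qed
  then have "iso_bnd n u (sqrt K)" unfolding iso_bnd_def by blast
  then show ?thesis using K0 by (intro exI[of _ "sqrt K"]) auto
qed

lemma iso_bnd_contr:
  assumes "iso_bnd n u L" "contr s U" "contr t V"
  shows "bnd n u L s U t V"
proof -
  obtain s' U' where U': "s \<le> s'" "iso_ent s' U'" "\<And>a x \<sigma>. \<sigma> < s \<Longrightarrow> U' a x \<sigma> = U a x \<sigma>"
    using contr_extends_to_iso[OF assms(2)] by blast
  obtain t' V' where V': "t \<le> t'" "iso_ent t' V'" "\<And>a x \<sigma>. \<sigma> < t \<Longrightarrow> V' a x \<sigma> = V a x \<sigma>"
    using contr_extends_to_iso[OF assms(3)] by blast
  have b: "bnd n u L s' U' t' V'" using assms(1) U'(2) V'(2) unfolding iso_bnd_def by blast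
  show ?thesis unfolding bnd_def
  proof
    fix z :: "nat \<Rightarrow> complex"
    let ?g = "\<lambda>p \<sigma> \<tau>. sq (\<Sum>q<n. wsum u U' V' p q \<sigma> \<tau> * z q)"
    have "(\<Sum>p<n. \<Sum>\<sigma><s. \<Sum>\<tau><t. sq (\<Sum>q<n. wsum u U V p q \<sigma> \<tau> * z q)) = (\<Sum>p<n. \<Sum>\<sigma><s. \<Sum>\<tau><t. ?g p \<sigma> \<tau>)"
      unfolding wsum_def using U'(3) V'(3) by simp
    also have "\<dots> \<le> (\<Sum>p<n. \<Sum>\<sigma><s. \<Sum>\<tau><t'. ?g p \<sigma> \<tau>)"
      using V'(1) by (intro sum_mono sum_mono2) auto
    also have "\<dots> \<le> (\<Sum>p<n. \<Sum>\<sigma><s'. \<Sum>\<tau><t'. ?g p \<sigma> \<tau>)"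
      using U'(1) by (intro sum_mono sum_mono2) (auto intro!: sum_nonneg)
    also have "\<dots> \<le> L\<^sup>2 * (\<Sum>q<n. sq (z q))" using b unfolding bnd_def by blast
    finally show "(\<Sum>p<n. \<Sum>\<sigma><s. \<Sum>\<tau><t. sq (\<Sum>q<n. wsum u U V p q \<sigma> \<tau> * z q)) \<le> L\<^sup>2 * (\<Sum>q<n. sq (z q))" .
  qed
qed

subsection \<open>The norm of local isometries\<close>

lemma sum_Times: "(\<Sum>p\<in>A \<times> B. f p) = (\<Sum>a\<in>A. \<Sum>b\<in>B. f (a, b))"
  by (simp add: sum.cartesian_product)

lemma Kset_eq_Sigma:
  "Kset Ws = (SIGMA i:{..<length Ws}. {..<fst (Ws ! i)} \<times> {..<fst (snd (snd (Ws ! i)))})"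
  by (auto simp: Kset_def)

text \<open>The operator is block diagonal: rows of block \<open>i\<close> meet only the columns
  with \<open>j = i\<close>. So the quadratic form splits over the summands, each with its own
  independent test vector \<open>\<lambda>q. v (q, i)\<close>.\<close>

lemma phiW_norm_le_iff:
  assumes "0 \<le> L"
  shows "phiW_norm n Ws u \<le> L \<longleftrightarrow>
    (\<forall>v. (\<Sum>i<length Ws. \<Sum>p<n. \<Sum>\<sigma><fst (Ws ! i). \<Sum>\<tau><fst (snd (snd (Ws ! i))).
        sq (\<Sum>q<n. wsum u (fst (snd (Ws ! i))) (snd (snd (snd (Ws ! i)))) p q \<sigma> \<tau> * v (q, i)))
      \<le> L\<^sup>2 * (\<Sum>i<length Ws. \<Sum>q<n. sq (v (q, i))))"
proof -
  let ?M = "\<lambda>(p, \<kappa>) (q, j). \<Sum>xy\<in>UNIV. \<Sum>ab\<in>UNIV. u p q xy ab * Wentry Ws ab xy \<kappa> j"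
  let ?J = "{..<n} \<times> {..<length Ws}"
  let ?w = "\<lambda>i p q \<sigma> \<tau>. wsum u (fst (snd (Ws ! i))) (snd (snd (snd (Ws ! i)))) p q \<sigma> \<tau>"
  have fin: "finite (Kset Ws)" unfolding Kset_eq_Sigma by auto
  have row: "(\<Sum>qj\<in>?J. ?M (p, (i, \<sigma>, \<tau>)) qj * v qj) = (\<Sum>q<n. ?w i p q \<sigma> \<tau> * v (q, i))"
    if "i < length Ws" for v i p \<sigma> \<tau>
  proof -
    have "?M (p, (i, \<sigma>, \<tau>)) (q, j) * v (q, j) = (if i = j then ?w i p q \<sigma> \<tau> * v (q, i) else 0)" for q j
      by (simp add: Wentry_def wsum_def)
    then show ?thesis unfolding sum_Times using that by simp
  qed
  have Q: "(\<Sum>pk\<in>{..<n} \<times> Kset Ws. sq (\<Sum>qj\<in>?J. ?M pk qj * v qj))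
    = (\<Sum>i<length Ws. \<Sum>p<n. \<Sum>\<sigma><fst (Ws ! i). \<Sum>\<tau><fst (snd (snd (Ws ! i))).
        sq (\<Sum>q<n. ?w i p q \<sigma> \<tau> * v (q, i)))" for v
  proof -
    have "(\<Sum>pk\<in>{..<n} \<times> Kset Ws. sq (\<Sum>qj\<in>?J. ?M pk qj * v qj))
      = (\<Sum>p<n. \<Sum>\<kappa>\<in>Kset Ws. sq (\<Sum>qj\<in>?J. ?M (p, \<kappa>) qj * v qj))"
      by (rule sum_Times)
    also have "\<dots> = (\<Sum>p<n. \<Sum>i<length Ws. \<Sum>\<sigma>\<tau>\<in>{..<fst (Ws ! i)} \<times> {..<fst (snd (snd (Ws ! i)))}.
        sq (\<Sum>qj\<in>?J. ?M (p, (i, \<sigma>\<tau>)) qj * v qj))"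
      unfolding Kset_eq_Sigma by (simp add: sum.Sigma)
    also have "\<dots> = (\<Sum>p<n. \<Sum>i<length Ws. \<Sum>\<sigma><fst (Ws ! i). \<Sum>\<tau><fst (snd (snd (Ws ! i))).
        sq (\<Sum>q<n. ?w i p q \<sigma> \<tau> * v (q, i)))"
    proof (intro sum.cong refl)
      fix p i assume "i \<in> {..<length Ws}"
      then have i: "i < length Ws" by simp
      show "(\<Sum>\<sigma>\<tau>\<in>{..<fst (Ws ! i)} \<times> {..<fst (snd (snd (Ws ! i)))}.
          sq (\<Sum>qj\<in>?J. ?M (p, (i, \<sigma>\<tau>)) qj * v qj))
        = (\<Sum>\<sigma><fst (Ws ! i). \<Sum>\<tau><fst (snd (snd (Ws ! i))). sq (\<Sum>q<n. ?w i p q \<sigma> \<tau> * v (q, i)))"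
        by (simp only: sum_Times[of _ "{..<fst (Ws ! i)}"] row[OF i])
    qed
    finally show ?thesis by (subst sum.swap)
  qed
  have N: "(\<Sum>qj\<in>?J. sq (v qj)) = (\<Sum>i<length Ws. \<Sum>q<n. sq (v (q, i)))" for v
    unfolding sum_Times by (rule sum.swap)
  show ?thesis unfolding phiW_norm_def opn_le_iff[OF finite_cartesian_product[OF finite_lessThan fin]
        finite_cartesian_product[OF finite_lessThan finite_lessThan] assms] Q N ..
qed

text \<open>Extending the zero contraction with \<open>s = 0\<close> lets the extension lemma choose
  a large enough ancilla.\<close>

lemma iso_ent_exists: "\<exists>s U. iso_ent s (U :: 'a::finite \<Rightarrow> 'x::finite \<Rightarrow> nat \<Rightarrow> complex)"
proof -
  have "contr 0 (\<lambda>(a::'a) (x::'x) \<sigma>. 0)" unfolding contr_def by (simp add: sum_nonneg)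
  from contr_extends_to_iso[OF this] show ?thesis by blast
qed

lemma Rloc_nonempty: "Rloc \<noteq> ({} :: ('a::finite,'b::finite,'x::finite,'y::finite) loc_data set)"
proof -
  obtain s U t V where "iso_ent s (U :: 'a \<Rightarrow> 'x \<Rightarrow> nat \<Rightarrow> complex)" "iso_ent t (V :: 'b \<Rightarrow> 'y \<Rightarrow> nat \<Rightarrow> complex)"
    using iso_ent_exists by metis
  then have "[(s, U, t, V)] \<in> Rloc" by (simp add: Rloc_def)
  then show ?thesis by blast
qed

lemma phiW_norm_le_of_iso_bnd:
  assumes "0 \<le> L" "iso_bnd n u L" "Ws \<in> Rloc"
  shows "phiW_norm n Ws u \<le> L"
  unfolding phiW_norm_le_iff[OF assms(1)] sum_distrib_left
proof (rule allI, rule sum_mono)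
  fix v i assume "i \<in> {..<length Ws}"
  then have "bnd n u L (fst (Ws ! i)) (fst (snd (Ws ! i))) (fst (snd (snd (Ws ! i)))) (snd (snd (snd (Ws ! i))))"
    using assms(2,3) by (auto simp: Rloc_def iso_bnd_def)
  from this[unfolded bnd_def, rule_format, of "\<lambda>q. v (q, i)"]
  show "(\<Sum>p<n. \<Sum>\<sigma><fst (Ws ! i). \<Sum>\<tau><fst (snd (snd (Ws ! i))).
        sq (\<Sum>q<n. wsum u (fst (snd (Ws ! i))) (snd (snd (snd (Ws ! i)))) p q \<sigma> \<tau> * v (q, i)))
      \<le> (\<Sum>q<n. L\<^sup>2 * sq (v (q, i)))"
    by (simp only: sum_distrib_left)
qed

lemma
  fixes u :: "nat \<Rightarrow> nat \<Rightarrow> ('x::finite \<times> 'y::finite) \<Rightarrow> ('a::finite \<times> 'b::finite) \<Rightarrow> complex"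
  shows loc_norm_nonneg: "0 \<le> loc_norm n u"
    and loc_norm_le_iff: "0 \<le> L \<Longrightarrow> loc_norm n u \<le> L \<longleftrightarrow> iso_bnd n u L"
proof -
  let ?S = "{phiW_norm n Ws u | Ws :: ('a,'b,'x,'y) loc_data. Ws \<in> Rloc}"
  obtain L0 where "0 \<le> L0" "iso_bnd n u L0" using iso_bnd_exists by blast
  then have bdd: "bdd_above ?S" using phiW_norm_le_of_iso_bnd by (intro bdd_aboveI[of _ L0]) blast
  have ne: "?S \<noteq> {}" using Rloc_nonempty by blast
  have upper: "phiW_norm n Ws u \<le> loc_norm n u" if "Ws \<in> Rloc" for Ws :: "('a,'b,'x,'y) loc_data"
    unfolding loc_norm_def using that bdd by (intro cSup_upper) auto
  obtain Ws :: "('a,'b,'x,'y) loc_data" where "Ws \<in> Rloc" using Rloc_nonempty by blast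
  have "0 \<le> phiW_norm n Ws u"
    unfolding phiW_norm_def Kset_eq_Sigma by (intro opn_nonneg) auto
  then show "0 \<le> loc_norm n u" using upper[OF \<open>Ws \<in> Rloc\<close>] by linarith
  show "loc_norm n u \<le> L \<longleftrightarrow> iso_bnd n u L" if "0 \<le> L"
  proof
    assume le: "loc_norm n u \<le> L"
    show "iso_bnd n u L" unfolding iso_bnd_def bnd_def
    proof (intro allI impI)
      fix s t and z :: "nat \<Rightarrow> complex"
        and U :: "'a \<Rightarrow> 'x \<Rightarrow> nat \<Rightarrow> complex" and V :: "'b \<Rightarrow> 'y \<Rightarrow> nat \<Rightarrow> complex"
      assume "iso_ent s U" "iso_ent t V"
      \<comment> \<open>A direct sum with one term recovers a single pair of isometries.\<close>
      then have "[(s, U, t, V)] \<in> Rloc" by (simp add: Rloc_def)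
      then have "phiW_norm n [(s, U, t, V)] u \<le> L" using upper le by (meson order_trans)
      from this[unfolded phiW_norm_le_iff[OF that], rule_format, of "\<lambda>(q, i). z q"]
      show "(\<Sum>p<n. \<Sum>\<sigma><s. \<Sum>\<tau><t. sq (\<Sum>q<n. wsum u U V p q \<sigma> \<tau> * z q)) \<le> L\<^sup>2 * (\<Sum>q<n. sq (z q))"
        by simp
    qed
  next
    assume "iso_bnd n u L"
    then show "loc_norm n u \<le> L"
      unfolding loc_norm_def using ne phiW_norm_le_of_iso_bnd[OF that] by (intro cSup_least) blast+
  qed
qed

subsection \<open>Orthonormal families in square-summable sequences\<close>

text \<open>Linear in the second argument. The series is under control only on \<open>ell2\<close>,
  which is why the rules below carry membership hypotheses.\<close>

definition ip :: "(nat \<Rightarrow> complex) \<Rightarrow> (nat \<Rightarrow> complex) \<Rightarrow> complex" where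
  "ip f g = (\<Sum>k. cnj (f k) * g k)"

definition orthonormal :: "nat \<Rightarrow> (nat \<Rightarrow> nat \<Rightarrow> complex) \<Rightarrow> bool" where
  "orthonormal d f \<longleftrightarrow> (\<forall>l<d. f l \<in> ell2) \<and>
    (\<forall>l<d. \<forall>l'<d. ip (f l) (f l') = (if l = l' then 1 else 0))"

definition comb :: "nat \<Rightarrow> (nat \<Rightarrow> nat \<Rightarrow> complex) \<Rightarrow> (nat \<Rightarrow> complex) \<Rightarrow> nat \<Rightarrow> complex" where
  "comb d f c k = (\<Sum>l<d. c l * f l k)"

lemma summable_ip: "f \<in> ell2 \<Longrightarrow> g \<in> ell2 \<Longrightarrow> summable (\<lambda>k. cnj (f k) * g k)"
  by (intro ell2_summable_mult ell2_cnj)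

lemma ip_scale_right: "f \<in> ell2 \<Longrightarrow> g \<in> ell2 \<Longrightarrow> ip f (\<lambda>k. c * g k) = c * ip f g"
  unfolding ip_def using suminf_mult[OF summable_ip, of f g c] by (simp add: mult.left_commute)

lemma ip_add_right:
  "f \<in> ell2 \<Longrightarrow> g \<in> ell2 \<Longrightarrow> h \<in> ell2 \<Longrightarrow> ip f (\<lambda>k. g k + h k) = ip f g + ip f h"
  unfolding ip_def using suminf_add[OF summable_ip[of f g] summable_ip[of f h]]
  by (simp add: distrib_left)

lemma ip_diff_right:
  "f \<in> ell2 \<Longrightarrow> g \<in> ell2 \<Longrightarrow> h \<in> ell2 \<Longrightarrow> ip f (\<lambda>k. g k - h k) = ip f g - ip f h"
  unfolding ip_def using suminf_diff[OF summable_ip[of f g] summable_ip[of f h]]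
  by (simp add: right_diff_distrib)

lemma ell2_diff: "f \<in> ell2 \<Longrightarrow> g \<in> ell2 \<Longrightarrow> (\<lambda>k. f k - g k) \<in> ell2"
  using ell2_add[of f "\<lambda>k. (-1) * g k"] ell2_scale[of g "-1"] by simp

lemma ip_sum_right:
  assumes "f \<in> ell2" "\<And>i. i \<in> I \<Longrightarrow> g i \<in> ell2" "finite I"
  shows "ip f (\<lambda>k. \<Sum>i\<in>I. c i * g i k) = (\<Sum>i\<in>I. c i * ip f (g i))"
  using assms(3,2)
proof (induction rule: finite_induct)
  case empty
  show ?case by (simp add: ip_def)
next
  case (insert i F)
  have "(\<lambda>k. \<Sum>i\<in>F. c i * g i k) \<in> ell2"
    using insert by (intro ell2_sum ell2_scale) auto
  then show ?case
    using insert assms(1) by (simp add: ip_add_right ell2_scale ip_scale_right)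
qed

lemma ip_commute:
  assumes "f \<in> ell2" "g \<in> ell2"
  shows "ip g f = cnj (ip f g)"
proof -
  have "(\<lambda>k. cnj (f k) * g k) sums ip f g"
    unfolding ip_def by (intro summable_sums summable_ip assms)
  then have "(\<lambda>k. cnj (cnj (f k) * g k)) sums cnj (ip f g)" by (simp only: sums_cnj)
  then show ?thesis unfolding ip_def by (simp add: sums_iff mult.commute)
qed

lemma ip_self:
  assumes "f \<in> ell2"
  shows "ip f f = complex_of_real (ell2sq f)"
  unfolding ip_def ell2sq_def cnj_mult_self
  using assms by (intro suminf_of_real[symmetric]) (simp add: ell2_def)

lemma orthonormal_ell2: "orthonormal d f \<Longrightarrow> l < d \<Longrightarrow> f l \<in> ell2"
  by (simp add: orthonormal_def)

lemma comb_ell2: "orthonormal d f \<Longrightarrow> comb d f c \<in> ell2"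
  unfolding comb_def by (intro ell2_sum ell2_scale) (simp add: orthonormal_def)

lemma ip_comb_right:
  assumes "orthonormal d f" "g \<in> ell2"
  shows "ip g (comb d f c) = (\<Sum>l<d. c l * ip g (f l))"
  unfolding comb_def using assms by (intro ip_sum_right) (auto simp: orthonormal_def)

lemma ip_basis_comb:
  assumes "orthonormal d f" "l < d"
  shows "ip (f l) (comb d f c) = c l"
proof -
  have "ip (f l) (comb d f c) = (\<Sum>l'<d. c l' * (if l = l' then 1 else 0))"
    using assms by (subst ip_comb_right) (auto simp: orthonormal_def)
  then show ?thesis using assms(2) by (simp add: if_distrib cong: if_cong)
qed

lemma ip_comb_comb:
  assumes "orthonormal d f"
  shows "ip (comb d f a) (comb d f b) = (\<Sum>l<d. cnj (a l) * b l)"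
  unfolding ip_comb_right[OF assms comb_ell2[OF assms]]
proof (rule sum.cong)
  fix l assume "l \<in> {..<d}"
  then have "ip (comb d f a) (f l) = cnj (a l)"
    using ip_commute[OF orthonormal_ell2[OF assms] comb_ell2[OF assms], of l a] ip_basis_comb[OF assms]
    by simp
  then show "b l * ip (comb d f a) (f l) = cnj (a l) * b l" by simp
qed simp

lemma ell2sq_comb:
  assumes "orthonormal d f"
  shows "ell2sq (comb d f c) = (\<Sum>l<d. sq (c l))"
proof -
  have "complex_of_real (ell2sq (comb d f c)) = complex_of_real (\<Sum>l<d. sq (c l))"
    unfolding ip_self[OF comb_ell2[OF assms], symmetric] ip_comb_comb[OF assms] cnj_mult_self by simp
  then show ?thesis by (simp only: of_real_eq_iff)
qed

text \<open>The pairing in \<open>rown\<close> has no conjugation, so the family dual to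
  \<open>f\<close> under it is the conjugated one.\<close>

lemma orthonormal_cnj:
  assumes "orthonormal d f"
  shows "orthonormal d (\<lambda>l k. cnj (f l k))"
proof -
  have "ip (\<lambda>k. cnj (f l k)) (\<lambda>k. cnj (f l' k)) = ip (f l') (f l)" for l l'
    by (simp add: ip_def mult.commute)
  then show ?thesis using assms by (auto simp: orthonormal_def ell2_cnj)
qed

text \<open>The residual \<open>h\<close> is orthogonal to the projection \<open>comb d f a\<close>;
  Pythagoras then identifies \<open>ell2sq h\<close> with the gap in Bessel's inequality.\<close>

lemma
  fixes g :: "nat \<Rightarrow> complex"
  assumes f: "orthonormal d f" and g: "g \<in> ell2"
  defines "a \<equiv> \<lambda>l. ip (f l) g"
  defines "h \<equiv> \<lambda>k. g k - comb d f a k"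
  shows residual_ell2: "h \<in> ell2"
    and residual_orthogonal: "l < d \<Longrightarrow> ip (f l) h = 0"
    and bessel: "(\<Sum>l<d. sq (a l)) \<le> ell2sq g"
proof -
  show h: "h \<in> ell2" unfolding h_def by (intro ell2_diff g comb_ell2 f)
  show orth: "ip (f l) h = 0" if "l < d" for l
    using that f g unfolding h_def
    by (subst ip_diff_right) (auto simp: orthonormal_ell2 comb_ell2 ip_basis_comb a_def)
  have "ip h (comb d f a) = 0"
    unfolding ip_comb_right[OF f h] using orth ip_commute[OF orthonormal_ell2[OF f] h] by simp
  then have "ip h h = ip h g"
    using ip_diff_right[OF h g comb_ell2[OF f], of a] by (simp add: h_def)
  also have "\<dots> = cnj (ip g h)" by (rule ip_commute[OF g h])
  also have "ip g h = ip g g - ip g (comb d f a)"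
    unfolding h_def by (rule ip_diff_right[OF g g comb_ell2[OF f]])
  also have "ip g (comb d f a) = (\<Sum>l<d. a l * cnj (a l))"
    unfolding ip_comb_right[OF f g] a_def
    using ip_commute[OF orthonormal_ell2[OF f] g] by simp
  also have "\<dots> = complex_of_real (\<Sum>l<d. sq (a l))"
    by (simp add: cnj_mult_self mult.commute[of _ "cnj _"])
  finally have "ip h h = complex_of_real (ell2sq g - (\<Sum>l<d. sq (a l)))"
    by (simp add: ip_self[OF g])
  then have "ell2sq h = ell2sq g - (\<Sum>l<d. sq (a l))"
    unfolding ip_self[OF h] by (simp only: of_real_eq_iff)
  then show "(\<Sum>l<d. sq (a l)) \<le> ell2sq g" using ell2sq_nonneg[OF h] by simp
qed

text \<open>The vectors may be dependent: a zero residual adds no basis vector, so \<open>d\<close>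
  can be smaller than the size of \<open>I\<close>.\<close>

lemma gram_schmidt:
  assumes "finite I" "\<And>i. i \<in> I \<Longrightarrow> v i \<in> ell2"
  shows "\<exists>d f c. orthonormal d f \<and> (\<forall>i\<in>I. v i = comb d f (c i))"
  using assms
proof (induction rule: finite_induct)
  case empty
  show ?case by (intro exI[of _ 0]) (simp add: orthonormal_def)
next
  case (insert i0 F)
  then obtain d f c where f: "orthonormal d f" and c: "\<And>i. i \<in> F \<Longrightarrow> v i = comb d f (c i)"
    by auto
  have vi: "v i0 \<in> ell2" using insert.prems by simp
  define a where "a l = ip (f l) (v i0)" for l
  define h where "h k = v i0 k - comb d f a k" for k
  have h: "h \<in> ell2" and orth: "\<And>l. l < d \<Longrightarrow> ip (f l) h = 0"
    using residual_ell2[OF f vi] residual_orthogonal[OF f vi] by (simp_all add: h_def[abs_def] a_def[abs_def])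
  have neq: "i \<noteq> i0" if "i \<in> F" for i using that insert.hyps by auto
  show ?case
  proof (cases "ell2sq h = 0")
    case True
    have "v i0 = comb d f a"
    proof
      fix k
      show "v i0 k = comb d f a k" using ell2sq_eq_0D[OF h True, of k] by (simp add: h_def)
    qed
    then have "\<forall>i\<in>insert i0 F. v i = comb d f ((c(i0 := a)) i)" using c neq by auto
    then show ?thesis using f by blast
  next
    case False
    then have N: "0 < ell2sq h" using ell2sq_nonneg[OF h] by simp
    define s where "s = complex_of_real (sqrt (ell2sq h))"
    have s: "s \<noteq> 0" "s * s = ell2sq h" "cnj s = s" using N by (auto simp: s_def simp flip: of_real_mult)
    define e where "e k = inverse s * h k" for k
    have e: "e \<in> ell2" unfolding e_def[abs_def] by (rule ell2_scale[OF h])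
    have fe: "ip (f l) e = 0" if "l < d" for l
      unfolding e_def[abs_def] using ip_scale_right[OF orthonormal_ell2[OF f that] h] orth[OF that] by simp
    have ef: "ip e (f l) = 0" if "l < d" for l
      using ip_commute[OF orthonormal_ell2[OF f that] e] fe[OF that] by simp
    have "ell2sq e = sq (inverse s) * ell2sq h" unfolding e_def[abs_def] by (rule ell2sq_scale[OF h])
    then have "ell2sq e = 1" using N by (simp add: s_def norm_inverse power_inverse)
    then have ee: "ip e e = 1" by (simp add: ip_self[OF e])
    have "orthonormal (Suc d) (f(d := e))"
      using f e fe ef ee by (auto simp: orthonormal_def less_Suc_eq)
    moreover
    \<comment> \<open>As \<open>h\<close> is \<open>s\<close> times \<open>e\<close>, the new vector
      has last coefficient \<open>s\<close>; the old vectors have 0 there.\<close>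
    define c' where "c' i l = (if i = i0 then (if l < d then a l else s) else if l < d then c i l else 0)" for i l
    have cs: "comb (Suc d) (f(d := e)) b k = comb d f b k + b d * e k" for b k
      by (simp add: comb_def)
    have cc: "comb d f b k = comb d f b' k" if "\<And>l. l < d \<Longrightarrow> b l = b' l" for b b' k
      using that by (simp add: comb_def)
    have "v i = comb (Suc d) (f(d := e)) (c' i)" if "i \<in> insert i0 F" for i
    proof
      fix k
      show "v i k = comb (Suc d) (f(d := e)) (c' i) k"
      proof (cases "i = i0")
        case True
        have "comb d f (c' i) k = comb d f a k" by (rule cc) (simp add: c'_def True)
        moreover have "c' i d * e k = h k" using s(1) by (simp add: c'_def True e_def)
        ultimately show ?thesis unfolding cs by (simp add: h_def True)
      next
        case False
        have "comb d f (c' i) k = comb d f (c i) k" by (rule cc) (simp add: c'_def False)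
        then show ?thesis unfolding cs using that False c by (simp add: c'_def)
      qed
    qed
    ultimately show ?thesis by blast
  qed
qed

subsection \<open>Complete contractions from the row space\<close>

text \<open>Replaces l2 by C^d in the row norm inequality, by testing it on the span of the
  conjugated family, where the bilinear pairing becomes the plain product of coefficients.\<close>

lemma rown_comb_le:
  assumes f: "orthonormal d f" and fin: "finite I" "finite J"
    and r: "\<And>i j. i \<in> I \<Longrightarrow> j \<in> J \<Longrightarrow> r i j = comb d f (c i j)"
    and le: "rown I J r \<le> 1"
  shows "(\<Sum>i\<in>I. sq (\<Sum>j\<in>J. \<Sum>l<d. c i j l * \<eta> j l)) \<le> (\<Sum>j\<in>J. \<Sum>l<d. sq (\<eta> j l))"
proof -
  define \<zeta> where "\<zeta> j = comb d (\<lambda>l k. cnj (f l k)) (\<eta> j)" for j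
  have cf: "orthonormal d (\<lambda>l k. cnj (f l k))" by (rule orthonormal_cnj[OF f])
  have \<zeta>: "\<zeta> j \<in> ell2" for j unfolding \<zeta>_def by (rule comb_ell2[OF cf])
  have "(\<Sum>k. r i j k * \<zeta> j k) = (\<Sum>l<d. c i j l * \<eta> j l)" if "i \<in> I" "j \<in> J" for i j
  proof -
    have "(\<Sum>k. r i j k * \<zeta> j k) = ip (comb d f (\<lambda>l. cnj (\<eta> j l))) (comb d f (c i j))"
      by (simp add: ip_def r[OF that] \<zeta>_def comb_def mult.commute)
    then show ?thesis by (simp add: ip_comb_comb[OF f] mult.commute)
  qed
  moreover have "(\<Sum>i\<in>I. sq (\<Sum>j\<in>J. \<Sum>k. r i j k * \<zeta> j k)) \<le> 1\<^sup>2 * (\<Sum>j\<in>J. ell2sq (\<zeta> j))"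
    using le r \<zeta> comb_ell2[OF f] by (subst (asm) rown_le_iff[OF fin]) auto
  ultimately show ?thesis by (simp add: \<zeta>_def ell2sq_comb[OF cf])
qed

text \<open>A single column, meant as part of a square matrix of size \<open>Suc d\<close>: the size
  must be positive also for \<open>d = 0\<close>, and row \<open>d\<close> is zero.\<close>

definition column :: "nat \<Rightarrow> (nat \<Rightarrow> nat \<Rightarrow> complex) \<Rightarrow> nat \<Rightarrow> nat \<Rightarrow> nat \<Rightarrow> complex" where
  "column d f p q = (if q = 0 \<and> p < d then f p else (\<lambda>_. 0))"

lemma column_simps:
  "p < d \<Longrightarrow> column d f p 0 = f p" "column d f p (Suc q) = (\<lambda>_. 0)" "column d f d q = (\<lambda>_. 0)"
  by (simp_all add: column_def)

text \<open>The column sends a vector to its coefficients against the conjugated family, so its norm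
  is bounded by Bessel's inequality.\<close>

lemma
  assumes f: "orthonormal d f"
  shows column_ell2: "column d f p q \<in> ell2"
    and rown_column_le: "rown {..<Suc d} {..<Suc d} (column d f) \<le> 1"
proof -
  show mem: "column d f p q \<in> ell2" for p q
    using orthonormal_ell2[OF f] by (simp add: column_def ell2_zero)
  show "rown {..<Suc d} {..<Suc d} (column d f) \<le> 1"
    unfolding rown_le_iff[OF finite_lessThan finite_lessThan mem zero_le_one]
  proof (intro allI impI)
    fix \<eta> :: "nat \<Rightarrow> nat \<Rightarrow> complex" assume \<eta>: "\<forall>j\<in>{..<Suc d}. \<eta> j \<in> ell2"
    have "(\<Sum>i<Suc d. sq (\<Sum>j<Suc d. \<Sum>k. column d f i j k * \<eta> j k))
      = (\<Sum>i<Suc d. sq (\<Sum>k. column d f i 0 k * \<eta> 0 k))"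
      unfolding sum.lessThan_Suc_shift[of _ d] by (simp add: column_simps)
    also have "\<dots> = (\<Sum>i<d. sq (ip (\<lambda>k. cnj (f i k)) (\<eta> 0)))"
      by (simp add: column_simps ip_def)
    also have "\<dots> \<le> ell2sq (\<eta> 0)" using bessel[OF orthonormal_cnj[OF f], of "\<eta> 0"] \<eta> by simp
    also have "\<dots> \<le> (\<Sum>j<Suc d. ell2sq (\<eta> j))"
      using \<eta> by (intro member_le_sum) (auto intro: ell2sq_nonneg)
    finally show "(\<Sum>i<Suc d. sq (\<Sum>j<Suc d. \<Sum>k. column d f i j k * \<eta> j k)) \<le> 1\<^sup>2 * (\<Sum>j<Suc d. ell2sq (\<eta> j))"
      by simp
  qed
qed

text \<open>Applying \<open>\<alpha>\<close> to the column of the \<open>f l\<close> stacks the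
  matrices \<open>\<alpha> (f l)\<close> on top of each other, and this stack is the operator in
  question.\<close>

lemma row_cc_contr:
  fixes \<alpha> :: "(nat \<Rightarrow> complex) \<Rightarrow> 'a::finite \<Rightarrow> 'x::finite \<Rightarrow> complex"
  assumes \<alpha>: "row_cc \<alpha>" and f: "orthonormal d f"
  shows "contr d (\<lambda>a x l. \<alpha> (f l) a x)"
  unfolding contr_def
proof
  fix w :: "'x \<Rightarrow> complex"
  let ?r = "column d f"
  have "mnormM (Suc d) (\<lambda>p q. \<alpha> (?r p q)) \<le> 1"
    using \<alpha> column_ell2[OF f] rown_column_le[OF f] unfolding row_cc_def by (metis zero_less_Suc)
  \<comment> \<open>Test vectors supported on the first block column, where all non-zero entries of
    \<open>column\<close> sit.\<close>
  from this[unfolded mnormM_def, THEN opn_le_iff[THEN iffD1, rotated -1], rule_format, of "\<lambda>(q, x). if q = 0 then w x else 0"]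
  have "(\<Sum>p<Suc d. \<Sum>a\<in>UNIV. sq (\<Sum>q<Suc d. \<Sum>x\<in>UNIV. \<alpha> (?r p q) a x * (if q = 0 then w x else 0)))
    \<le> (\<Sum>q<Suc d. \<Sum>x\<in>UNIV. sq (if q = 0 then w x else 0))"
    by (simp add: sum_Times del: sum.lessThan_Suc)
  then have "(\<Sum>p<Suc d. \<Sum>a\<in>UNIV. sq (\<Sum>x\<in>UNIV. \<alpha> (?r p 0) a x * w x)) \<le> (\<Sum>x\<in>UNIV. sq (w x))"
    unfolding sum.lessThan_Suc_shift[of "\<lambda>q. \<Sum>x\<in>UNIV. sq (if q = 0 then w x else 0)" d]
      sum.lessThan_Suc_shift[of "\<lambda>q. \<Sum>x\<in>UNIV. \<alpha> (?r _ q) _ x * (if q = 0 then w x else 0)" d]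
    by simp
  \<comment> \<open>The padding row \<open>p = d\<close> is dropped as a non-negative term.\<close>
  then have "(\<Sum>p<d. \<Sum>a\<in>UNIV. sq (\<Sum>x\<in>UNIV. \<alpha> (f p) a x * w x)) \<le> (\<Sum>x\<in>UNIV. sq (w x))"
    by (simp add: column_simps) (smt (verit) sum_nonneg zero_le_power2)
  then show "(\<Sum>a\<in>UNIV. \<Sum>l<d. sq (\<Sum>x\<in>UNIV. \<alpha> (f l) a x * w x)) \<le> (\<Sum>x\<in>UNIV. sq (w x))"
    by (subst sum.swap)
qed

lemma row_cc_zero: "row_cc \<alpha> \<Longrightarrow> \<alpha> (\<lambda>k. 0) = (\<lambda>a x. 0)"
proof -
  assume "row_cc \<alpha>"
  then have "\<alpha> (\<lambda>k. 0 * 0) = (\<lambda>a x. 0 * \<alpha> (\<lambda>k. 0) a x)"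
    unfolding row_cc_def using ell2_zero by blast
  then show ?thesis by simp
qed

text \<open>\<open>row_cc\<close> grants linearity only inside \<open>ell2\<close>, hence the
  induction over partial combinations, which stay there by \<open>comb_ell2\<close>.\<close>

lemma row_cc_comb:
  assumes \<alpha>: "row_cc \<alpha>" and f: "orthonormal d f"
  shows "\<alpha> (comb d f c) a x = (\<Sum>l<d. c l * \<alpha> (f l) a x)"
proof -
  have "m \<le> d \<Longrightarrow> \<alpha> (comb m f c) a x = (\<Sum>l<m. c l * \<alpha> (f l) a x)" for m
  proof (induction m)
    case 0
    show ?case using row_cc_zero[OF \<alpha>] by (simp add: comb_def[abs_def])
  next
    case (Suc m)
    have "orthonormal m f" using f Suc.prems by (simp add: orthonormal_def)
    then have 1: "comb m f c \<in> ell2" by (rule comb_ell2)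
    have 2: "f m \<in> ell2" using orthonormal_ell2[OF f] Suc.prems by simp
    have "comb (Suc m) f c = (\<lambda>k. comb m f c k + c m * f m k)" by (simp add: comb_def[abs_def])
    then have "\<alpha> (comb (Suc m) f c) = (\<lambda>a x. \<alpha> (comb m f c) a x + \<alpha> (\<lambda>k. c m * f m k) a x)"
      using \<alpha> 1 ell2_scale[OF 2] unfolding row_cc_def by simp
    moreover have "\<alpha> (\<lambda>k. c m * f m k) = (\<lambda>a x. c m * \<alpha> (f m) a x)"
      using \<alpha> 2 unfolding row_cc_def by simp
    ultimately show ?case using Suc by simp
  qed
  then show ?thesis by simp
qed

text \<open>The amplified operator is U applied to every part of \<open>v\<close>, followed by
  \<open>r\<close> acting on the l2 factor alone; both are contractions.\<close>

lemma row_cc_of_contr: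
  fixes U :: "'a::finite \<Rightarrow> 'x::finite \<Rightarrow> nat \<Rightarrow> complex"
  assumes U: "contr s U"
  shows "row_cc (\<lambda>\<xi> a x. \<Sum>k<s. \<xi> k * U a x k)"
  unfolding row_cc_def
proof (intro conjI allI impI)
  fix m :: nat and r :: "nat \<Rightarrow> nat \<Rightarrow> nat \<Rightarrow> complex"
  assume "0 < m \<and> (\<forall>p<m. \<forall>q<m. r p q \<in> ell2) \<and> rown {..<m} {..<m} r \<le> 1"
  then have r: "\<And>p q. p \<in> {..<m} \<Longrightarrow> q \<in> {..<m} \<Longrightarrow> r p q \<in> ell2" and le: "rown {..<m} {..<m} r \<le> 1"
    by auto
  have le': "(\<Sum>p<m. sq (\<Sum>q<m. \<Sum>k. r p q k * \<zeta> q k)) \<le> (\<Sum>q<m. ell2sq (\<zeta> q))"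
    if "\<And>q. \<zeta> q \<in> ell2" for \<zeta>
    using le r that by (subst (asm) rown_le_iff[OF finite_lessThan finite_lessThan]) auto
  show "mnormM m (\<lambda>p q a x. \<Sum>k<s. r p q k * U a x k) \<le> 1"
    unfolding mnormM_def
  proof (subst opn_le_iff, simp_all only: finite_cartesian_product finite_lessThan finite zero_le_one, rule allI)
    fix v :: "nat \<times> 'x \<Rightarrow> complex"
    \<comment> \<open>The \<open>a\<close>-block of the image under U of the \<open>q\<close>-th
      part of \<open>v\<close>, continued by zero to a sequence on which \<open>r\<close> can
      act.\<close>
    define \<eta> where "\<eta> a q k = (if k < s then \<Sum>x\<in>UNIV. U a x k * v (q, x) else 0)" for a q k
    have \<eta>: "\<eta> a q \<in> ell2" "ell2sq (\<eta> a q) = (\<Sum>k<s. sq (\<Sum>x\<in>UNIV. U a x k * v (q, x)))" for a q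
      using ell2_finite_support[of s "\<eta> a q"] by (auto simp: \<eta>_def)
    have r\<eta>: "(\<Sum>k. r p q k * \<eta> a q k) = (\<Sum>x\<in>UNIV. (\<Sum>k<s. r p q k * U a x k) * v (q, x))" for p q a
    proof -
      have "(\<Sum>k. r p q k * \<eta> a q k) = (\<Sum>k<s. r p q k * \<eta> a q k)"
        by (rule suminf_finite) (auto simp: \<eta>_def)
      also have "\<dots> = (\<Sum>k<s. \<Sum>x\<in>UNIV. r p q k * U a x k * v (q, x))"
        by (simp add: \<eta>_def sum_distrib_left mult.assoc)
      also have "\<dots> = (\<Sum>x\<in>UNIV. (\<Sum>k<s. r p q k * U a x k) * v (q, x))"
        by (subst sum.swap) (simp add: sum_distrib_right)
      finally show ?thesis .
    qed
    have "(\<Sum>p<m. \<Sum>a\<in>UNIV. sq (\<Sum>q<m. \<Sum>x\<in>UNIV. (\<Sum>k<s. r p q k * U a x k) * v (q, x)))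
      = (\<Sum>a\<in>UNIV. \<Sum>p<m. sq (\<Sum>q<m. \<Sum>k. r p q k * \<eta> a q k))"
      unfolding r\<eta> by (rule sum.swap)
    also have "\<dots> \<le> (\<Sum>a\<in>UNIV. \<Sum>q<m. ell2sq (\<eta> a q))"
      using le' \<eta>(1) by (intro sum_mono[where K = UNIV]) simp
    also have "\<dots> = (\<Sum>q<m. \<Sum>a\<in>UNIV. \<Sum>k<s. sq (\<Sum>x\<in>UNIV. U a x k * v (q, x)))"
      unfolding \<eta>(2) by (rule sum.swap)
    also have "\<dots> \<le> (\<Sum>q<m. \<Sum>x\<in>UNIV. sq (v (q, x)))"
      by (rule sum_mono) (rule U[unfolded contr_def, rule_format])
    finally show "(\<Sum>i\<in>{..<m} \<times> UNIV. sq (\<Sum>j\<in>{..<m} \<times> UNIV.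
        (case i of (p, a) \<Rightarrow> \<lambda>(q, x). \<Sum>k<s. r p q k * U a x k) j * v j))
      \<le> 1\<^sup>2 * (\<Sum>j\<in>{..<m} \<times> UNIV. sq (v j))"
      by (simp add: sum_Times)
  qed
qed (auto simp: algebra_simps sum.distrib sum_distrib_left)

subsection \<open>Complete contractions into the column space\<close>

definition pairing ::
  "(nat \<Rightarrow> nat \<Rightarrow> 'y::finite \<Rightarrow> 'b::finite \<Rightarrow> complex)
   \<Rightarrow> (nat \<Rightarrow> nat \<Rightarrow> 'b \<Rightarrow> 'y \<Rightarrow> complex) \<Rightarrow> nat \<times> nat \<Rightarrow> nat \<times> nat \<Rightarrow> complex" where
  "pairing s T = (\<lambda>(i, p) (j, q). \<Sum>y\<in>UNIV. \<Sum>b\<in>UNIV. s p q y b * T i j b y)"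

definition unit_ball_M :: "nat \<Rightarrow> (nat \<Rightarrow> nat \<Rightarrow> 'b::finite \<Rightarrow> 'y::finite \<Rightarrow> complex) \<Rightarrow> bool" where
  "unit_ball_M k T \<longleftrightarrow>
    (\<forall>v. (\<Sum>i<k. \<Sum>b\<in>UNIV. sq (\<Sum>j<k. \<Sum>y\<in>UNIV. T i j b y * v (j, y)))
       \<le> (\<Sum>j<k. \<Sum>y\<in>UNIV. sq (v (j, y))))"

lemma s1n_eq:
  fixes s :: "nat \<Rightarrow> nat \<Rightarrow> 'y::finite \<Rightarrow> 'b::finite \<Rightarrow> complex"
  shows "s1n m s = Sup {opn ({..<k} \<times> {..<m}) ({..<k} \<times> {..<m}) (pairing s T) | k T. 0 < k \<and> unit_ball_M k T}"
proof -
  have "opn ({..<k} \<times> UNIV) ({..<k} \<times> UNIV) (\<lambda>(i, b) (j, y). T i j b y) \<le> 1 \<longleftrightarrow> unit_ball_M k T"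
    for k and T :: "nat \<Rightarrow> nat \<Rightarrow> 'b \<Rightarrow> 'y \<Rightarrow> complex"
    by (subst opn_le_iff) (simp_all add: sum_Times unit_ball_M_def)
  then show ?thesis unfolding s1n_def pairing_def by simp
qed

lemma opn_pairing_le_iff:
  "0 \<le> L \<Longrightarrow> opn ({..<k} \<times> {..<m}) ({..<k} \<times> {..<m}) (pairing s T) \<le> L \<longleftrightarrow>
    (\<forall>v. (\<Sum>i<k. \<Sum>p<m. sq (\<Sum>j<k. \<Sum>q<m. (\<Sum>y\<in>UNIV. \<Sum>b\<in>UNIV. s p q y b * T i j b y) * v (j, q)))
      \<le> L\<^sup>2 * (\<Sum>j<k. \<Sum>q<m. sq (v (j, q))))"
  by (subst opn_le_iff) (simp_all add: sum_Times pairing_def)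

text \<open>Each block \<open>T\<^sub>b\<^sub>y\<close> of a contraction is itself a contraction on \<open>\<complex>\<^sup>k\<close>, which gives
  a bound on the pairing that does not depend on \<open>k\<close>.\<close>

lemma opn_pairing_bound:
  fixes s :: "nat \<Rightarrow> nat \<Rightarrow> 'y::finite \<Rightarrow> 'b::finite \<Rightarrow> complex"
  assumes T: "unit_ball_M k T"
  shows "opn ({..<k} \<times> {..<m}) ({..<k} \<times> {..<m}) (pairing s T)
    \<le> sqrt ((\<Sum>p<m. \<Sum>q<m. \<Sum>y\<in>UNIV. \<Sum>b\<in>UNIV. sq (s p q y b)) * (card (UNIV :: 'y set) * card (UNIV :: 'b set)))"
    (is "_ \<le> sqrt (?S * ?c)")
proof (subst opn_pairing_le_iff)
  have S0: "0 \<le> ?S * ?c" by (intro mult_nonneg_nonneg sum_nonneg) auto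
  then show "0 \<le> sqrt (?S * ?c)" by simp
  have blk: "(\<Sum>i<k. sq (\<Sum>j<k. T i j b y * w j)) \<le> (\<Sum>j<k. sq (w j))" for b y w
  proof -
    have "(\<Sum>i<k. sq (\<Sum>j<k. T i j b y * w j))
      \<le> (\<Sum>i<k. \<Sum>b'\<in>UNIV. sq (\<Sum>j<k. T i j b' y * w j))"
      by (intro sum_mono member_le_sum) auto
    \<comment> \<open>Here \<open>T\<close> is tested on a vector supported at the single label
      \<open>y\<close>.\<close>
    also have "\<dots> \<le> (\<Sum>j<k. sq (w j))"
      using T[unfolded unit_ball_M_def, rule_format, of "\<lambda>(j, y'). if y' = y then w j else 0"]
      by (simp add: if_distrib if_distribR cong: if_cong)
    finally show ?thesis .
  qed
  show "\<forall>v. (\<Sum>i<k. \<Sum>p<m. sq (\<Sum>j<k. \<Sum>q<m. (\<Sum>y\<in>UNIV. \<Sum>b\<in>UNIV. s p q y b * T i j b y) * v (j, q)))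
      \<le> (sqrt (?S * ?c))\<^sup>2 * (\<Sum>j<k. \<Sum>q<m. sq (v (j, q)))"
  proof
    fix v :: "nat \<times> nat \<Rightarrow> complex"
    define t where "t i q y b = (\<Sum>j<k. T i j b y * v (j, q))" for i q y b
    define C where "C p = (\<Sum>q<m. \<Sum>y\<in>UNIV. \<Sum>b\<in>UNIV. sq (s p q y b))" for p
    define E where "E i = (\<Sum>q<m. \<Sum>y\<in>UNIV. \<Sum>b\<in>UNIV. sq (t i q y b))" for i
    have row: "(\<Sum>j<k. \<Sum>q<m. (\<Sum>y\<in>UNIV. \<Sum>b\<in>UNIV. s p q y b * T i j b y) * v (j, q))
      = (\<Sum>q<m. \<Sum>y\<in>UNIV. \<Sum>b\<in>UNIV. s p q y b * t i q y b)" for i p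
    proof -
      have "(\<Sum>j<k. \<Sum>q<m. (\<Sum>y\<in>UNIV. \<Sum>b\<in>UNIV. s p q y b * T i j b y) * v (j, q))
        = (\<Sum>q<m. \<Sum>j<k. \<Sum>y\<in>UNIV. \<Sum>b\<in>UNIV. s p q y b * (T i j b y * v (j, q)))"
        by (subst sum.swap) (simp add: sum_distrib_right mult.assoc)
      also have "\<dots> = (\<Sum>q<m. \<Sum>y\<in>UNIV. \<Sum>j<k. \<Sum>b\<in>UNIV. s p q y b * (T i j b y * v (j, q)))"
        by (intro sum.cong refl sum.swap)
      also have "\<dots> = (\<Sum>q<m. \<Sum>y\<in>UNIV. \<Sum>b\<in>UNIV. \<Sum>j<k. s p q y b * (T i j b y * v (j, q)))"
        by (intro sum.cong refl sum.swap)
      finally show ?thesis by (simp add: t_def sum_distrib_left)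
    qed
    \<comment> \<open>Cauchy-Schwarz over the triples (q, y, b) separates \<open>s\<close> from
      \<open>T\<close>. In what remains, \<open>blk\<close> applies once for each pair (y, b), which
      explains the factor \<open>?c\<close>.\<close>
    have "(\<Sum>i<k. \<Sum>p<m. sq (\<Sum>q<m. \<Sum>y\<in>UNIV. \<Sum>b\<in>UNIV. s p q y b * t i q y b)) \<le> (\<Sum>i<k. \<Sum>p<m. C p * E i)"
    proof (rule sum_mono, rule sum_mono)
      fix i p
      show "sq (\<Sum>q<m. \<Sum>y\<in>UNIV. \<Sum>b\<in>UNIV. s p q y b * t i q y b) \<le> C p * E i"
        unfolding C_def E_def sum.cartesian_product case_prod_unfold by (rule sq_sum_mult_le)
    qed
    also have "\<dots> = ?S * (\<Sum>i<k. E i)"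
      unfolding C_def[symmetric] by (subst sum.swap) (simp only: sum_product)
    also have "\<dots> \<le> ?S * (?c * (\<Sum>j<k. \<Sum>q<m. sq (v (j, q))))"
    proof (rule mult_left_mono)
      have "(\<Sum>i<k. E i) = (\<Sum>q<m. \<Sum>y\<in>UNIV. \<Sum>b\<in>UNIV. \<Sum>i<k. sq (t i q y b))"
      proof -
        have "(\<Sum>i<k. E i) = (\<Sum>q<m. \<Sum>i<k. \<Sum>y\<in>UNIV. \<Sum>b\<in>UNIV. sq (t i q y b))"
          unfolding E_def by (rule sum.swap)
        also have "\<dots> = (\<Sum>q<m. \<Sum>y\<in>UNIV. \<Sum>i<k. \<Sum>b\<in>UNIV. sq (t i q y b))"
          by (intro sum.cong refl sum.swap)
        also have "\<dots> = (\<Sum>q<m. \<Sum>y\<in>UNIV. \<Sum>b\<in>UNIV. \<Sum>i<k. sq (t i q y b))"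
          by (intro sum.cong refl sum.swap)
        finally show ?thesis .
      qed
      also have "\<dots> \<le> (\<Sum>q<m. \<Sum>y::'y\<in>UNIV. \<Sum>b::'b\<in>UNIV. \<Sum>j<k. sq (v (j, q)))"
        unfolding t_def by (rule sum_mono, rule sum_mono, rule sum_mono, rule blk)
      also have "\<dots> = ?c * (\<Sum>q<m. \<Sum>j<k. sq (v (j, q)))"
        by (simp add: sum_distrib_left mult.assoc)
      also have "(\<Sum>q<m. \<Sum>j<k. sq (v (j, q))) = (\<Sum>j<k. \<Sum>q<m. sq (v (j, q)))" by (rule sum.swap)
      finally show "(\<Sum>i<k. E i) \<le> ?c * (\<Sum>j<k. \<Sum>q<m. sq (v (j, q)))" .
    qed (intro sum_nonneg, simp)
    finally show "(\<Sum>i<k. \<Sum>p<m. sq (\<Sum>j<k. \<Sum>q<m. (\<Sum>y\<in>UNIV. \<Sum>b\<in>UNIV. s p q y b * T i j b y) * v (j, q)))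
      \<le> (sqrt (?S * ?c))\<^sup>2 * (\<Sum>j<k. \<Sum>q<m. sq (v (j, q)))"
      unfolding row real_sqrt_pow2[OF S0] by (simp only: mult.assoc)
  qed
qed

lemma s1n_le_1_iff:
  fixes s :: "nat \<Rightarrow> nat \<Rightarrow> 'a::finite \<Rightarrow> 'b::finite \<Rightarrow> complex"
  shows "s1n m s \<le> 1 \<longleftrightarrow> (\<forall>k T. 0 < k \<longrightarrow> unit_ball_M k T \<longrightarrow>
    (\<forall>v. (\<Sum>i<k. \<Sum>p<m. sq (\<Sum>j<k. \<Sum>q<m. (\<Sum>y\<in>UNIV. \<Sum>b\<in>UNIV. s p q y b * T i j b y) * v (j, q)))
      \<le> (\<Sum>j<k. \<Sum>q<m. sq (v (j, q)))))"
proof -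
  let ?A = "{opn ({..<k} \<times> {..<m}) ({..<k} \<times> {..<m}) (pairing s T) | k T. 0 < k \<and> unit_ball_M k T}"
  have "unit_ball_M 1 (\<lambda>i j b y. 0)" by (simp add: unit_ball_M_def sum_nonneg)
  then have "opn ({..<1} \<times> {..<m}) ({..<1} \<times> {..<m}) (pairing s (\<lambda>i j b y. 0)) \<in> ?A"
    using zero_less_one by blast
  then have ne: "?A \<noteq> {}" by blast
  have bdd: "bdd_above ?A"
  proof (rule bdd_aboveI)
    fix x assume "x \<in> ?A"
    then obtain k T where "x = opn ({..<k} \<times> {..<m}) ({..<k} \<times> {..<m}) (pairing s T)" "unit_ball_M k T"
      by blast
    then show "x \<le> sqrt ((\<Sum>p<m. \<Sum>q<m. \<Sum>y\<in>UNIV. \<Sum>b\<in>UNIV. sq (s p q y b)) * (card (UNIV :: 'a set) * card (UNIV :: 'b set)))"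
      using opn_pairing_bound by simp
  qed
  have "s1n m s \<le> 1 \<longleftrightarrow> (\<forall>k T. 0 < k \<longrightarrow> unit_ball_M k T \<longrightarrow>
      opn ({..<k} \<times> {..<m}) ({..<k} \<times> {..<m}) (pairing s T) \<le> 1)"
    unfolding s1n_eq cSup_le_iff[OF ne bdd] by blast
  then show ?thesis by (simp only: opn_pairing_le_iff[OF zero_le_one] power_one mult_1)
qed

text \<open>The map pairs with one particular \<open>T\<close>, the block column of the slices of V.
  It lies in the unit ball because V is a contraction, so the definition of the dual norm gives the
  bound at once.\<close>

lemma col_cc_of_contr:
  fixes V :: "'b::finite \<Rightarrow> 'y::finite \<Rightarrow> nat \<Rightarrow> complex"
  assumes V: "contr t V"
  shows "col_cc (\<lambda>S k. if k < t then \<Sum>y\<in>UNIV. \<Sum>b\<in>UNIV. S y b * V b y k else 0)"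
    (is "col_cc ?\<beta>")
proof -
  have mem: "?\<beta> S \<in> ell2" for S by (rule ell2_finite_support[of t]) simp
  have cc: "coln {..<m} {..<m} (\<lambda>p q. ?\<beta> (s p q)) \<le> 1" if "0 < m" and s: "s1n m s \<le> 1" for m s
    unfolding coln_le_iff[OF finite_lessThan finite_lessThan mem zero_le_one]
  proof
    fix z :: "nat \<Rightarrow> complex"
    \<comment> \<open>Padded from a column to a square matrix; the size \<open>Suc t\<close> below
      is positive also for \<open>t = 0\<close>.\<close>
    define T where "T i j b y = (if i < t \<and> j = 0 then V b y i else 0)" for i j :: nat and b y
    have T0: "i < t \<Longrightarrow> T i 0 b y = V b y i" and TS: "T i (Suc j) b y = 0" and Tt: "T t j b y = 0" for i j b y
      by (simp_all add: T_def)
    have "unit_ball_M (Suc t) T" unfolding unit_ball_M_def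
    proof
      fix v :: "nat \<times> 'y \<Rightarrow> complex"
      have "(\<Sum>i<Suc t. \<Sum>b\<in>UNIV. sq (\<Sum>j<Suc t. \<Sum>y\<in>UNIV. T i j b y * v (j, y)))
        = (\<Sum>i<Suc t. \<Sum>b\<in>UNIV. sq (\<Sum>y\<in>UNIV. T i 0 b y * v (0, y)))"
        unfolding sum.lessThan_Suc_shift[of _ t] by (simp add: TS)
      also have "\<dots> = (\<Sum>i<t. \<Sum>b\<in>UNIV. sq (\<Sum>y\<in>UNIV. V b y i * v (0, y)))"
        by (simp add: Tt T0)
      also have "\<dots> = (\<Sum>b\<in>UNIV. \<Sum>i<t. sq (\<Sum>y\<in>UNIV. V b y i * v (0, y)))" by (rule sum.swap)
      also have "\<dots> \<le> (\<Sum>y\<in>UNIV. sq (v (0, y)))"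
        using V[unfolded contr_def, rule_format, of "\<lambda>y. v (0, y)"] .
      also have "\<dots> \<le> (\<Sum>j<Suc t. \<Sum>y\<in>UNIV. sq (v (j, y)))"
        by (rule member_le_sum) (auto intro: sum_nonneg)
      finally show "(\<Sum>i<Suc t. \<Sum>b\<in>UNIV. sq (\<Sum>j<Suc t. \<Sum>y\<in>UNIV. T i j b y * v (j, y)))
        \<le> (\<Sum>j<Suc t. \<Sum>y\<in>UNIV. sq (v (j, y)))" .
    qed
    from s[unfolded s1n_le_1_iff, rule_format, OF _ this, of "\<lambda>(j, q). if j = 0 then z q else 0"]
    have *: "(\<Sum>i<Suc t. \<Sum>p<m. sq (\<Sum>q<m. (\<Sum>y\<in>UNIV. \<Sum>b\<in>UNIV. s p q y b * T i 0 b y) * z q)) \<le> (\<Sum>q<m. sq (z q))"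
      unfolding sum.lessThan_Suc_shift[of "\<lambda>j. \<Sum>q<m. _ j q" t] by (simp del: sum.lessThan_Suc)
    have "(\<Sum>p<m. ell2sq (\<lambda>k. \<Sum>q<m. ?\<beta> (s p q) k * z q))
      = (\<Sum>p<m. \<Sum>k<t. sq (\<Sum>q<m. (\<Sum>y\<in>UNIV. \<Sum>b\<in>UNIV. s p q y b * V b y k) * z q))"
      by (intro sum.cong refl, subst ell2_finite_support(2)[of t]) auto
    also have "\<dots> = (\<Sum>i<t. \<Sum>p<m. sq (\<Sum>q<m. (\<Sum>y\<in>UNIV. \<Sum>b\<in>UNIV. s p q y b * T i 0 b y) * z q))"
      by (subst sum.swap) (simp add: T0)
    also have "\<dots> \<le> (\<Sum>i<Suc t. \<Sum>p<m. sq (\<Sum>q<m. (\<Sum>y\<in>UNIV. \<Sum>b\<in>UNIV. s p q y b * T i 0 b y) * z q))"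
      by (intro sum_mono2) (auto intro: sum_nonneg)
    finally show "(\<Sum>p<m. ell2sq (\<lambda>k. \<Sum>q<m. ?\<beta> (s p q) k * z q)) \<le> 1\<^sup>2 * (\<Sum>q<m. sq (z q))"
      using * by simp
  qed
  show ?thesis unfolding col_cc_def
    using mem cc by (auto simp: algebra_simps sum.distrib sum_distrib_left)
qed

section \<open>Coordinates for complete contractions into the column space\<close>

lemma finite_inj_bounded: "\<exists>g m. inj (g :: 'i::finite \<Rightarrow> nat) \<and> (\<forall>i. g i < m)"
proof -
  obtain g :: "'i \<Rightarrow> nat" and m where g: "range g = {i. i < m}" "inj g"
    using finite_imp_inj_to_nat_seg[OF finite_UNIV] by metis
  then have "g i < m" for i by (metis mem_Collect_eq rangeI)
  then show ?thesis using g(2) by blast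
qed

lemma sum_inj_le:
  fixes g :: "'i::finite \<Rightarrow> nat" and h :: "nat \<Rightarrow> real"
  assumes "inj g" "\<And>i. g i < m" "\<And>q. 0 \<le> h q"
  shows "(\<Sum>i\<in>UNIV. h (g i)) \<le> (\<Sum>q<m. h q)"
proof -
  have "(\<Sum>i\<in>UNIV. h (g i)) = sum h (range g)" using assms(1) by (simp add: sum.reindex)
  also have "\<dots> \<le> (\<Sum>q<m. h q)" using assms by (intro sum_mono2) auto
  finally show ?thesis .
qed

lemma sum_inj_eq:
  fixes g :: "'i::finite \<Rightarrow> nat" and h :: "nat \<Rightarrow> 'c::comm_monoid_add"
  assumes "inj g" "\<And>i. g i < m" "\<And>q. q \<notin> range g \<Longrightarrow> h q = 0"
  shows "(\<Sum>q<m. h q) = (\<Sum>i\<in>UNIV. h (g i))"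
proof -
  have "(\<Sum>q<m. h q) = sum h (range g)"
    using assms by (intro sum.mono_neutral_right) auto
  then show ?thesis using assms(1) by (simp add: sum.reindex)
qed

definition munit :: "'y \<Rightarrow> 'b \<Rightarrow> 'y \<Rightarrow> 'b \<Rightarrow> complex" where
  "munit y b = (\<lambda>y' b'. if y' = y \<and> b' = b then 1 else 0)"

lemma sum_munit:
  fixes f :: "'y::finite \<Rightarrow> 'b::finite \<Rightarrow> complex"
  shows "(\<Sum>y'\<in>UNIV. \<Sum>b'\<in>UNIV. munit y b y' b' * f y' b') = f y b"
proof -
  have "(\<Sum>y'\<in>UNIV. \<Sum>b'\<in>UNIV. munit y b y' b' * f y' b') = (\<Sum>p\<in>UNIV. if p = (y, b) then f y b else 0)"
    unfolding sum_UNIV_prod by (intro sum.cong refl) (auto simp: munit_def)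
  then show ?thesis by simp
qed

lemma col_cc_zero: "col_cc \<beta> \<Longrightarrow> \<beta> (\<lambda>y b. 0) = (\<lambda>k. 0)"
proof -
  assume "col_cc \<beta>"
  then have "\<beta> (\<lambda>y b. c * S y b) = (\<lambda>k. c * \<beta> S k)" for c S
    by (simp add: col_cc_def)
  from this[of 0 "\<lambda>y b. 0"]
  have "\<beta> (\<lambda>y b. 0 * 0) = (\<lambda>k. 0 * \<beta> (\<lambda>y b. 0) k)" .
  then show ?thesis by simp
qed

lemma col_cc_expand:
  fixes \<beta> :: "('y::finite \<Rightarrow> 'b::finite \<Rightarrow> complex) \<Rightarrow> nat \<Rightarrow> complex"
  assumes \<beta>: "col_cc \<beta>"
  shows "\<beta> S k = (\<Sum>y\<in>UNIV. \<Sum>b\<in>UNIV. S y b * \<beta> (munit y b) k)"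
proof -
  have add: "\<beta> (\<lambda>y b. S y b + S' y b) = (\<lambda>k. \<beta> S k + \<beta> S' k)"
    and scale: "\<beta> (\<lambda>y b. c * S y b) = (\<lambda>k. c * \<beta> S k)" for c S S'
    using \<beta> unfolding col_cc_def by simp_all
  have lin: "\<beta> (\<lambda>y' b'. \<Sum>i\<in>I. c i * F i y' b') = (\<lambda>k. \<Sum>i\<in>I. c i * \<beta> (F i) k)"
    if "finite I" for I :: "('y \<times> 'b) set" and c and F :: "'y \<times> 'b \<Rightarrow> 'y \<Rightarrow> 'b \<Rightarrow> complex"
    using that
  proof (induction rule: finite_induct)
    case empty
    show ?case using col_cc_zero[OF \<beta>] by simp
  next
    case (insert i I)
    have "\<beta> (\<lambda>y' b'. c i * F i y' b' + (\<Sum>i\<in>I. c i * F i y' b'))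
      = (\<lambda>k. \<beta> (\<lambda>y' b'. c i * F i y' b') k + \<beta> (\<lambda>y' b'. \<Sum>i\<in>I. c i * F i y' b') k)"
      by (rule add)
    moreover have "\<beta> (\<lambda>y' b'. c i * F i y' b') = (\<lambda>k. c i * \<beta> (F i) k)"
      by (rule scale)
    ultimately show ?case using insert by simp
  qed
  have "S = (\<lambda>y' b'. \<Sum>i\<in>UNIV. S (fst i) (snd i) * munit (fst i) (snd i) y' b')"
  proof (intro ext)
    fix y' :: 'y and b' :: 'b
    have "S y' b' = (\<Sum>y\<in>UNIV. \<Sum>b\<in>UNIV. munit y' b' y b * S y b)" by (rule sum_munit[symmetric])
    also have "\<dots> = (\<Sum>y\<in>UNIV. \<Sum>b\<in>UNIV. S y b * munit y b y' b')"
      by (intro sum.cong refl) (auto simp: munit_def)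
    finally show "S y' b' = (\<Sum>i\<in>UNIV. S (fst i) (snd i) * munit (fst i) (snd i) y' b')"
      by (simp add: sum_UNIV_prod)
  qed
  then have "\<beta> S = \<beta> (\<lambda>y' b'. \<Sum>i\<in>UNIV. S (fst i) (snd i) * munit (fst i) (snd i) y' b')"
    by (rule arg_cong[where f = \<beta>])
  also have "\<dots> = (\<lambda>k. \<Sum>i\<in>UNIV. S (fst i) (snd i) * \<beta> (munit (fst i) (snd i)) k)"
    by (rule lin) simp
  finally show ?thesis by (simp add: sum_UNIV_prod)
qed

text \<open>Testing \<open>\<beta>\<close> on the identity of \<open>M\<^sub>B\<^sub>,\<^sub>Y\<close>, seen as a norm-one element \<open>(\<epsilon>\<^sub>y\<^sub>,\<^sub>b)\<^sub>b\<^sub>,\<^sub>y\<close> of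
  \<open>M\<^sub>B\<^sub>,\<^sub>Y(S\<^sub>1)\<close>; the row and column labels are injected into an initial segment of \<open>\<nat>\<close>.\<close>

lemma col_cc_column_contraction:
  fixes \<beta> :: "('y::finite \<Rightarrow> 'b::finite \<Rightarrow> complex) \<Rightarrow> nat \<Rightarrow> complex"
  assumes \<beta>: "col_cc \<beta>"
  shows "(\<Sum>b\<in>UNIV. ell2sq (\<lambda>k. \<Sum>y\<in>UNIV. \<beta> (munit y b) k * w y)) \<le> (\<Sum>y\<in>UNIV. sq (w y))"
proof -
  obtain gb m1 where gb: "inj (gb :: 'b \<Rightarrow> nat)" "\<And>b. gb b < m1" using finite_inj_bounded by blast
  obtain gy m2 where gy: "inj (gy :: 'y \<Rightarrow> nat)" "\<And>y. gy y < m2" using finite_inj_bounded by blast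
  \<comment> \<open>One square size with room for both labellings.\<close>
  define m where "m = m1 + m2"
  have gbm: "gb b < m" and gym: "gy y < m" for b y
    using gb(2)[of b] gy(2)[of y] by (simp_all add: m_def)
  have m: "0 < m" using gbm[of undefined] by simp
  define s where "s p q = (\<lambda>y b. if gb b = p \<and> gy y = q then 1 else 0 :: complex)" for p q
  have s: "s (gb b) (gy y) = munit y b" for y b
    using gb(1) gy(1) by (auto simp: s_def munit_def fun_eq_iff inj_eq)
  have sp: "s p q = (\<lambda>y b. 0)" if "p \<notin> range gb" for p q using that by (auto simp: s_def fun_eq_iff)
  have sq0: "s p q = (\<lambda>y b. 0)" if "q \<notin> range gy" for p q using that by (auto simp: s_def fun_eq_iff)
  have "s1n m s \<le> 1" unfolding s1n_le_1_iff
  proof (intro allI impI)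
    fix k T v assume T: "unit_ball_M k (T :: nat \<Rightarrow> nat \<Rightarrow> 'b \<Rightarrow> 'y \<Rightarrow> complex)"
    let ?t = "\<lambda>i j p q. \<Sum>y\<in>UNIV. \<Sum>b\<in>UNIV. s p q y b * T i j b y"
    \<comment> \<open>Pairing \<open>s\<close> with \<open>T\<close> just returns the entries of
      \<open>T\<close> under new labels, so contractivity of \<open>T\<close> is the whole
      estimate.\<close>
    have row: "(\<Sum>q<m. ?t i j (gb b) q * v (j, q)) = (\<Sum>y\<in>UNIV. T i j b y * v (j, gy y))" for i j b
      by (subst sum_inj_eq[OF gy(1) gym]) (simp_all add: sq0 s sum_munit)
    have "(\<Sum>i<k. \<Sum>p<m. sq (\<Sum>j<k. \<Sum>q<m. ?t i j p q * v (j, q)))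
      = (\<Sum>i<k. \<Sum>b\<in>UNIV. sq (\<Sum>j<k. \<Sum>q<m. ?t i j (gb b) q * v (j, q)))"
      by (subst sum_inj_eq[OF gb(1) gbm]) (simp_all add: sp)
    also have "\<dots> \<le> (\<Sum>j<k. \<Sum>y\<in>UNIV. sq (v (j, gy y)))"
      unfolding row using T[unfolded unit_ball_M_def, rule_format, of "\<lambda>(j, y). v (j, gy y)"] by simp
    also have "\<dots> \<le> (\<Sum>j<k. \<Sum>q<m. sq (v (j, q)))"
      by (rule sum_mono, rule sum_inj_le[OF gy(1) gym]) simp
    finally show "(\<Sum>i<k. \<Sum>p<m. sq (\<Sum>j<k. \<Sum>q<m. ?t i j p q * v (j, q))) \<le> (\<Sum>j<k. \<Sum>q<m. sq (v (j, q)))" .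
  qed
  then have le: "coln {..<m} {..<m} (\<lambda>p q. \<beta> (s p q)) \<le> 1"
    using \<beta> m unfolding col_cc_def by blast
  have mem: "\<beta> S \<in> ell2" for S using \<beta> by (simp add: col_cc_def)
  define z where "z q = (if q \<in> range gy then w (inv gy q) else 0)" for q
  have z: "z (gy y) = w y" for y using gy(1) by (simp add: z_def)
  have z0: "q \<notin> range gy \<Longrightarrow> z q = 0" for q by (simp add: z_def)
  have row: "(\<Sum>q<m. \<beta> (s (gb b) q) k * z q) = (\<Sum>y\<in>UNIV. \<beta> (munit y b) k * w y)" for b k
    by (subst sum_inj_eq[OF gy(1) gym]) (simp_all add: z z0 s)
  have nn: "0 \<le> ell2sq (\<lambda>k. \<Sum>q<m. \<beta> (s p q) k * z q)" for p
    using ell2_sum[of "{..<m}" "\<lambda>q k. z q * \<beta> (s p q) k"] mem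
    by (intro ell2sq_nonneg) (simp add: ell2_scale mult.commute)
  have "(\<Sum>b\<in>UNIV. ell2sq (\<lambda>k. \<Sum>q<m. \<beta> (s (gb b) q) k * z q)) \<le> (\<Sum>p<m. ell2sq (\<lambda>k. \<Sum>q<m. \<beta> (s p q) k * z q))"
    by (rule sum_inj_le[OF gb(1) gbm nn])
  also have "\<dots> \<le> (\<Sum>q<m. sq (z q))"
    using le[unfolded coln_le_iff[OF finite_lessThan finite_lessThan mem zero_le_one]] by simp
  also have "\<dots> = (\<Sum>y\<in>UNIV. sq (w y))"
    by (subst sum_inj_eq[OF gy(1) gym]) (simp_all add: z z0)
  finally show ?thesis unfolding row .
qed

lemma sum_comb:
  "(\<lambda>k. \<Sum>j\<in>J. comb t g (e j) k * z j) = comb t g (\<lambda>\<tau>. \<Sum>j\<in>J. e j \<tau> * z j)"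
proof
  fix k
  have "(\<Sum>j\<in>J. comb t g (e j) k * z j) = (\<Sum>j\<in>J. \<Sum>l<t. e j l * z j * g l k)"
    unfolding comb_def sum_distrib_right by (intro sum.cong refl) (simp add: mult_ac)
  also have "\<dots> = (\<Sum>l<t. \<Sum>j\<in>J. e j l * z j * g l k)" by (rule sum.swap)
  finally show "(\<Sum>j\<in>J. comb t g (e j) k * z j) = comb t g (\<lambda>\<tau>. \<Sum>j\<in>J. e j \<tau> * z j) k"
    by (simp add: comb_def sum_distrib_right)
qed

text \<open>The range of \<open>\<beta>\<close> is spanned by its finitely many values on matrix
  units. Gram-Schmidt gives an orthonormal family \<open>g\<close> for them, and V collects the
  coordinates, so the passage from l2 to C^t is exact.\<close>

lemma col_cc_rep:
  fixes \<beta> :: "('y::finite \<Rightarrow> 'b::finite \<Rightarrow> complex) \<Rightarrow> nat \<Rightarrow> complex"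
  assumes \<beta>: "col_cc \<beta>"
  shows "\<exists>t V g. contr t V \<and> orthonormal t g \<and>
    (\<forall>S. \<beta> S = comb t g (\<lambda>l. \<Sum>y\<in>UNIV. \<Sum>b\<in>UNIV. S y b * V b y l))"
proof -
  have mem: "\<beta> S \<in> ell2" for S using \<beta> by (simp add: col_cc_def)
  obtain t g c where g: "orthonormal t g" and c: "\<And>yb. \<beta> (munit (fst yb) (snd yb)) = comb t g (c yb)"
    using gram_schmidt[of "UNIV :: ('y \<times> 'b) set" "\<lambda>yb. \<beta> (munit (fst yb) (snd yb))"] mem by auto
  define V where "V b y = c (y, b)" for b y
  have V: "\<beta> (munit y b) = comb t g (V b y)" for y b using c[of "(y, b)"] by (simp add: V_def)
  have "contr t V" unfolding contr_def
  proof
    fix w :: "'y \<Rightarrow> complex"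
    have "(\<lambda>k. \<Sum>y\<in>UNIV. \<beta> (munit y b) k * w y) = comb t g (\<lambda>l. \<Sum>y\<in>UNIV. V b y l * w y)" for b
      unfolding V by (rule sum_comb)
    then show "(\<Sum>a\<in>UNIV. \<Sum>\<sigma><t. sq (\<Sum>x\<in>UNIV. V a x \<sigma> * w x)) \<le> (\<Sum>x\<in>UNIV. sq (w x))"
      using col_cc_column_contraction[OF \<beta>, of w] by (simp add: ell2sq_comb[OF g])
  qed
  moreover have "\<beta> S = comb t g (\<lambda>l. \<Sum>y\<in>UNIV. \<Sum>b\<in>UNIV. S y b * V b y l)" for S
  proof
    fix k
    have "\<beta> S k = (\<Sum>y\<in>UNIV. \<Sum>b\<in>UNIV. \<Sum>l<t. S y b * V b y l * g l k)"
      unfolding col_cc_expand[OF \<beta>, of S] V comb_def by (simp add: sum_distrib_left mult.assoc)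
    also have "\<dots> = (\<Sum>y\<in>UNIV. \<Sum>l<t. \<Sum>b\<in>UNIV. S y b * V b y l * g l k)"
      by (intro sum.cong refl sum.swap)
    also have "\<dots> = (\<Sum>l<t. \<Sum>y\<in>UNIV. \<Sum>b\<in>UNIV. S y b * V b y l * g l k)" by (rule sum.swap)
    finally show "\<beta> S k = comb t g (\<lambda>l. \<Sum>y\<in>UNIV. \<Sum>b\<in>UNIV. S y b * V b y l) k"
      by (simp add: comb_def sum_distrib_right)
  qed
  ultimately show ?thesis using g by blast
qed

subsection \<open>The weak cb norm\<close>

text \<open>The composition of the three maps in coordinates: a combination of slices of U enters
  \<open>omega_map\<close>, and the result is paired with the slice of V at
  \<open>\<tau>\<close>.\<close>

lemma omega_wsum:
  fixes u :: "nat \<Rightarrow> nat \<Rightarrow> ('x::finite \<times> 'y::finite) \<Rightarrow> ('a::finite \<times> 'b::finite) \<Rightarrow> complex"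
  shows "(\<Sum>y\<in>UNIV. \<Sum>b\<in>UNIV. omega_map u (\<lambda>a x. \<Sum>l<d. c l * U a x l) p q y b * V b y \<tau>)
    = (\<Sum>l<d. c l * wsum u U V p q l \<tau>)"
proof -
  let ?h = "\<lambda>l x y a b. c l * (u p q (x, y) (a, b) * (U a x l * V b y \<tau>))"
  have "(\<Sum>y\<in>UNIV. \<Sum>b\<in>UNIV. omega_map u (\<lambda>a x. \<Sum>l<d. c l * U a x l) p q y b * V b y \<tau>)
    = (\<Sum>yb\<in>UNIV. \<Sum>xa\<in>UNIV. \<Sum>l<d. ?h l (fst xa) (fst yb) (snd xa) (snd yb))"
    unfolding sum_UNIV_prod omega_map_def by (simp add: sum_distrib_left sum_distrib_right mult_ac)
  also have "\<dots> = (\<Sum>yb\<in>UNIV. \<Sum>l<d. \<Sum>xa\<in>UNIV. ?h l (fst xa) (fst yb) (snd xa) (snd yb))"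
    by (intro sum.cong refl sum.swap)
  also have "\<dots> = (\<Sum>l<d. \<Sum>yb\<in>UNIV. \<Sum>xa\<in>UNIV. ?h l (fst xa) (fst yb) (snd xa) (snd yb))"
    by (rule sum.swap)
  also have "\<dots> = (\<Sum>l<d. c l * wsum u U V p q l \<tau>)"
  proof (rule sum.cong)
    fix l
    have "(\<Sum>yb\<in>UNIV. \<Sum>xa\<in>UNIV. ?h l (fst xa) (fst yb) (snd xa) (snd yb))
      = (\<Sum>y\<in>UNIV. \<Sum>b\<in>UNIV. \<Sum>x\<in>UNIV. \<Sum>a\<in>UNIV. ?h l x y a b)"
      by (simp add: sum_UNIV_prod)
    also have "\<dots> = (\<Sum>y\<in>UNIV. \<Sum>x\<in>UNIV. \<Sum>b\<in>UNIV. \<Sum>a\<in>UNIV. ?h l x y a b)"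
      by (intro sum.cong refl sum.swap)
    also have "\<dots> = (\<Sum>x\<in>UNIV. \<Sum>y\<in>UNIV. \<Sum>b\<in>UNIV. \<Sum>a\<in>UNIV. ?h l x y a b)"
      by (rule sum.swap)
    also have "\<dots> = (\<Sum>x\<in>UNIV. \<Sum>y\<in>UNIV. \<Sum>a\<in>UNIV. \<Sum>b\<in>UNIV. ?h l x y a b)"
      by (intro sum.cong refl sum.swap)
    also have "\<dots> = c l * wsum u U V p q l \<tau>"
      unfolding wsum_def sum_UNIV_prod by (simp add: sum_distrib_left)
    finally show "(\<Sum>yb\<in>UNIV. \<Sum>xa\<in>UNIV. ?h l (fst xa) (fst yb) (snd xa) (snd yb)) = c l * wsum u U V p q l \<tau>" .
  qed simp
  finally show ?thesis .
qed

definition amplification ::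
  "((nat \<Rightarrow> complex) \<Rightarrow> nat \<Rightarrow> nat \<Rightarrow> nat \<Rightarrow> complex) \<Rightarrow> (nat \<Rightarrow> nat \<Rightarrow> nat \<Rightarrow> complex)
   \<Rightarrow> nat \<times> nat \<Rightarrow> nat \<times> nat \<Rightarrow> nat \<Rightarrow> complex" where
  "amplification \<Phi> r = (\<lambda>(i, p) (j, q). \<Phi> (r i j) p q)"

lemma coln_amplification_le_iff:
  assumes "\<And>\<xi> p q. \<Phi> \<xi> p q \<in> ell2" "0 \<le> L"
  shows "coln ({..<m} \<times> {..<n}) ({..<m} \<times> {..<n}) (amplification \<Phi> r) \<le> L \<longleftrightarrow>
    (\<forall>z. (\<Sum>i<m. \<Sum>p<n. ell2sq (\<lambda>k. \<Sum>j<m. \<Sum>q<n. \<Phi> (r i j) p q k * z (j, q)))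
      \<le> L\<^sup>2 * (\<Sum>j<m. \<Sum>q<n. sq (z (j, q))))"
  using assms by (subst coln_le_iff) (simp_all add: amplification_def sum_Times split: prod.split)

text \<open>After expanding \<open>r\<close> in an orthonormal family, the operator factors: first
  the operator of \<open>bnd\<close> on each of the \<open>m\<close> parts of \<open>z\<close>, then
  the coefficient matrix of \<open>r\<close> acting on the pairs (j, l). The second factor is a
  contraction and the first is bounded by \<open>L\<close>.\<close>

lemma coln_amplification_le:
  fixes u :: "nat \<Rightarrow> nat \<Rightarrow> ('x::finite \<times> 'y::finite) \<Rightarrow> ('a::finite \<times> 'b::finite) \<Rightarrow> complex"
  assumes L: "0 \<le> L" "iso_bnd n u L" and \<alpha>: "row_cc \<alpha>" and \<beta>: "col_cc \<beta>"
    and r: "\<And>i j. i < m \<Longrightarrow> j < m \<Longrightarrow> r i j \<in> ell2" and le: "rown {..<m} {..<m} r \<le> 1"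
  shows "coln ({..<m} \<times> {..<n}) ({..<m} \<times> {..<n})
    (amplification (\<lambda>\<xi> p q. \<beta> (omega_map u (\<alpha> \<xi>) p q)) r) \<le> L"
proof (subst coln_amplification_le_iff)
  show "\<beta> (omega_map u (\<alpha> \<xi>) p q) \<in> ell2" for \<xi> p q using \<beta> by (simp add: col_cc_def)
  show "0 \<le> L" by fact
  obtain d f c where f: "orthonormal d f"
    and c: "\<And>ij. ij \<in> {..<m} \<times> {..<m} \<Longrightarrow> r (fst ij) (snd ij) = comb d f (c ij)"
    using gram_schmidt[of "{..<m} \<times> {..<m}" "\<lambda>ij. r (fst ij) (snd ij)"] r by auto
  define U where "U a x l = \<alpha> (f l) a x" for a x l
  have U: "contr d U" unfolding U_def[abs_def] by (rule row_cc_contr[OF \<alpha> f])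
  obtain t V g where V: "contr t V" and g: "orthonormal t g"
    and \<beta>V: "\<And>S. \<beta> S = comb t g (\<lambda>l. \<Sum>y\<in>UNIV. \<Sum>b\<in>UNIV. S y b * V b y l)"
    using col_cc_rep[OF \<beta>] by blast
  let ?w = "wsum u U V"
  have r_c: "r i j = comb d f (c (i, j))" if "i < m" "j < m" for i j
    using c[of "(i, j)"] that by simp
  have \<Phi>: "\<beta> (omega_map u (\<alpha> (r i j)) p q) = comb t g (\<lambda>\<tau>. \<Sum>l<d. c (i, j) l * ?w p q l \<tau>)"
    if "i < m" "j < m" for i j p q
  proof -
    have "\<alpha> (r i j) = (\<lambda>a x. \<Sum>l<d. c (i, j) l * U a x l)"
      unfolding r_c[OF that] U_def by (intro ext row_cc_comb[OF \<alpha> f])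
    then show ?thesis unfolding \<beta>V by (simp only: omega_wsum)
  qed
  show "\<forall>z. (\<Sum>i<m. \<Sum>p<n. ell2sq (\<lambda>k. \<Sum>j<m. \<Sum>q<n. \<beta> (omega_map u (\<alpha> (r i j)) p q) k * z (j, q)))
    \<le> L\<^sup>2 * (\<Sum>j<m. \<Sum>q<n. sq (z (j, q)))"
  proof
    fix z :: "nat \<times> nat \<Rightarrow> complex"
    \<comment> \<open>The coordinate at (p, l, \<open>\<tau>\<close>) of the \<open>bnd\<close>
      operator applied to the \<open>j\<close>-th part of \<open>z\<close>.\<close>
    define \<eta> where "\<eta> p \<tau> j l = (\<Sum>q<n. ?w p q l \<tau> * z (j, q))" for p \<tau> j l
    have row: "ell2sq (\<lambda>k. \<Sum>j<m. \<Sum>q<n. \<beta> (omega_map u (\<alpha> (r i j)) p q) k * z (j, q))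
      = (\<Sum>\<tau><t. sq (\<Sum>j<m. \<Sum>l<d. c (i, j) l * \<eta> p \<tau> j l))" if "i < m" for i p
    proof -
      have "(\<lambda>k. \<Sum>j<m. \<Sum>q<n. \<beta> (omega_map u (\<alpha> (r i j)) p q) k * z (j, q))
        = (\<lambda>k. \<Sum>jq\<in>{..<m} \<times> {..<n}.
            comb t g (\<lambda>\<tau>. \<Sum>l<d. c (i, fst jq) l * ?w p (snd jq) l \<tau>) k * z jq)"
        by (simp add: sum_Times \<Phi>[OF that])
      also have "\<dots> = comb t g (\<lambda>\<tau>. \<Sum>jq\<in>{..<m} \<times> {..<n}.
            (\<Sum>l<d. c (i, fst jq) l * ?w p (snd jq) l \<tau>) * z jq)"
        by (rule sum_comb)
      also have "\<dots> = comb t g (\<lambda>\<tau>. \<Sum>j<m. \<Sum>l<d. c (i, j) l * \<eta> p \<tau> j l)"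
      proof -
        have "(\<Sum>q<n. (\<Sum>l<d. c (i, j) l * ?w p q l \<tau>) * z (j, q)) = (\<Sum>l<d. c (i, j) l * \<eta> p \<tau> j l)" for j \<tau>
          unfolding \<eta>_def sum_distrib_left sum_distrib_right mult.assoc by (rule sum.swap)
        then show ?thesis by (simp add: sum_Times)
      qed
      finally show ?thesis by (simp only: ell2sq_comb[OF g])
    qed
    have "(\<Sum>i<m. \<Sum>p<n. ell2sq (\<lambda>k. \<Sum>j<m. \<Sum>q<n. \<beta> (omega_map u (\<alpha> (r i j)) p q) k * z (j, q)))
      = (\<Sum>i<m. \<Sum>p<n. \<Sum>\<tau><t. sq (\<Sum>j<m. \<Sum>l<d. c (i, j) l * \<eta> p \<tau> j l))"
      by (simp add: row)
    also have "\<dots> = (\<Sum>p<n. \<Sum>i<m. \<Sum>\<tau><t. sq (\<Sum>j<m. \<Sum>l<d. c (i, j) l * \<eta> p \<tau> j l))"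
      by (rule sum.swap)
    also have "\<dots> = (\<Sum>p<n. \<Sum>\<tau><t. \<Sum>i<m. sq (\<Sum>j<m. \<Sum>l<d. c (i, j) l * \<eta> p \<tau> j l))"
      by (intro sum.cong refl sum.swap)
    \<comment> \<open>The coefficient matrix moves only (j, l), so \<open>p\<close> and
      \<open>\<tau>\<close> are held fixed.\<close>
    also have "\<dots> \<le> (\<Sum>p<n. \<Sum>\<tau><t. \<Sum>j<m. \<Sum>l<d. sq (\<eta> p \<tau> j l))"
    proof (rule sum_mono, rule sum_mono)
      fix p \<tau>
      show "(\<Sum>i<m. sq (\<Sum>j<m. \<Sum>l<d. c (i, j) l * \<eta> p \<tau> j l)) \<le> (\<Sum>j<m. \<Sum>l<d. sq (\<eta> p \<tau> j l))"
        by (rule rown_comb_le[OF f finite_lessThan finite_lessThan _ le]) (simp add: r_c)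
    qed
    also have "\<dots> = (\<Sum>p<n. \<Sum>j<m. \<Sum>\<tau><t. \<Sum>l<d. sq (\<eta> p \<tau> j l))"
      by (intro sum.cong refl sum.swap)
    also have "\<dots> = (\<Sum>j<m. \<Sum>p<n. \<Sum>\<tau><t. \<Sum>l<d. sq (\<eta> p \<tau> j l))"
      by (rule sum.swap)
    also have "\<dots> = (\<Sum>j<m. \<Sum>p<n. \<Sum>l<d. \<Sum>\<tau><t. sq (\<eta> p \<tau> j l))"
      by (intro sum.cong refl sum.swap)
    \<comment> \<open>Now \<open>j\<close> is held fixed and the bound for the pair (U, V)
      applies.\<close>
    also have "\<dots> \<le> (\<Sum>j<m. L\<^sup>2 * (\<Sum>q<n. sq (z (j, q))))"
      unfolding \<eta>_def
      by (rule sum_mono) (rule iso_bnd_contr[OF L(2) U V, unfolded bnd_def, rule_format])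
    finally show "(\<Sum>i<m. \<Sum>p<n. ell2sq (\<lambda>k. \<Sum>j<m. \<Sum>q<n. \<beta> (omega_map u (\<alpha> (r i j)) p q) k * z (j, q)))
      \<le> L\<^sup>2 * (\<Sum>j<m. \<Sum>q<n. sq (z (j, q)))"
      by (simp only: sum_distrib_left)
  qed
qed

lemma standard_basis_orthonormal: "orthonormal d (\<lambda>l k. if k = l then 1 else 0)"
proof -
  have "ip (\<lambda>k. if k = l then 1 else 0) (\<lambda>k. if k = l' then 1 else 0) = (if l = l' then 1 else 0)" for l l'
    unfolding ip_def by (subst suminf_finite[of "{l}"]) auto
  moreover have "(\<lambda>k. if k = l then 1 else 0) \<in> ell2" for l
    by (rule ell2_finite_support[of "Suc l"]) auto
  ultimately show ?thesis by (auto simp: orthonormal_def)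
qed

text \<open>On the column of the first \<open>s\<close> standard basis vectors,
  \<open>\<alpha>\<close> returns the slices of U, so the amplification is the \<open>bnd\<close>
  operator itself and no constant is lost.\<close>

lemma bnd_of_coln_amplification:
  fixes u :: "nat \<Rightarrow> nat \<Rightarrow> ('x::finite \<times> 'y::finite) \<Rightarrow> ('a::finite \<times> 'b::finite) \<Rightarrow> complex"
  assumes L: "0 \<le> L"
    and \<alpha>: "\<alpha> = (\<lambda>\<xi> a x. \<Sum>k<s. \<xi> k * U a x k)"
    and \<beta>: "\<beta> = (\<lambda>S k. if k < t then \<Sum>y\<in>UNIV. \<Sum>b\<in>UNIV. S y b * V b y k else 0)"
    and le: "coln ({..<Suc s} \<times> {..<n}) ({..<Suc s} \<times> {..<n})
      (amplification (\<lambda>\<xi> p q. \<beta> (omega_map u (\<alpha> \<xi>) p q)) (column s (\<lambda>l k. if k = l then 1 else 0))) \<le> L"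
  shows "bnd n u L s U t V"
  unfolding bnd_def
proof
  fix z :: "nat \<Rightarrow> complex"
  let ?r = "column s (\<lambda>l k. if k = l then 1 else 0)"
  let ?w = "wsum u U V"
  have \<Phi>: "\<beta> (omega_map u (\<alpha> \<xi>) p q) k = (if k < t then \<Sum>l<s. \<xi> l * ?w p q l k else 0)" for \<xi> p q k
    unfolding \<alpha> \<beta> omega_wsum ..
  have mem: "\<beta> (omega_map u (\<alpha> \<xi>) p q) \<in> ell2" for \<xi> p q
    by (rule ell2_finite_support[of t]) (simp add: \<Phi>)
  have \<Phi>r: "\<beta> (omega_map u (\<alpha> (?r i 0)) p q) k = (if k < t then ?w p q i k else 0)" if "i < s" for i p q k
    unfolding \<Phi> column_simps(1)[OF that] using that by (simp add: if_distrib if_distribR cong: if_cong)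
  define z' where "z' = (\<lambda>(j, q). if j = (0::nat) then z q else 0)"
  have z': "z' (0, q) = z q" "z' (Suc j, q) = 0" for j q by (simp_all add: z'_def)
  let ?G = "\<lambda>i p. ell2sq (\<lambda>k. \<Sum>q<n. \<beta> (omega_map u (\<alpha> (?r i 0)) p q) k * z q)"
  have "(\<Sum>i<Suc s. \<Sum>p<n. ell2sq (\<lambda>k. \<Sum>j<Suc s. \<Sum>q<n. \<beta> (omega_map u (\<alpha> (?r i j)) p q) k * z' (j, q)))
      \<le> L\<^sup>2 * (\<Sum>j<Suc s. \<Sum>q<n. sq (z' (j, q)))"
    using le[unfolded coln_amplification_le_iff[OF mem L]] by blast
  then have *: "(\<Sum>i<Suc s. \<Sum>p<n. ?G i p) \<le> L\<^sup>2 * (\<Sum>q<n. sq (z q))"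
    unfolding sum.lessThan_Suc_shift[of "\<lambda>j. \<Sum>q<n. sq (z' (j, q))"]
      sum.lessThan_Suc_shift[of "\<lambda>j. \<Sum>q<n. _ j q * z' (j, q)"]
    by (simp add: z' del: sum.lessThan_Suc)
  have "(\<Sum>p<n. \<Sum>\<sigma><s. \<Sum>\<tau><t. sq (\<Sum>q<n. ?w p q \<sigma> \<tau> * z q)) = (\<Sum>\<sigma><s. \<Sum>p<n. \<Sum>\<tau><t. sq (\<Sum>q<n. ?w p q \<sigma> \<tau> * z q))"
    by (rule sum.swap)
  also have "\<dots> = (\<Sum>i<s. \<Sum>p<n. ?G i p)"
  proof (intro sum.cong refl)
    fix i p assume "i \<in> {..<s}"
    then show "(\<Sum>\<tau><t. sq (\<Sum>q<n. ?w p q i \<tau> * z q)) = ?G i p"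
      by (subst ell2_finite_support(2)[of t]) (simp_all add: \<Phi>r)
  qed
  also have "\<dots> \<le> (\<Sum>i<Suc s. \<Sum>p<n. ?G i p)"
  proof -
    \<comment> \<open>The padding row \<open>i = s\<close> is left unevaluated; its sign
      suffices.\<close>
    have "0 \<le> ?G s p" for p
    proof (rule ell2sq_nonneg)
      show "(\<lambda>k. \<Sum>q<n. \<beta> (omega_map u (\<alpha> (?r s 0)) p q) k * z q) \<in> ell2"
        by (rule ell2_finite_support[of t]) (simp add: \<Phi>)
    qed
    then show ?thesis by (simp add: sum_nonneg)
  qed
  finally show "(\<Sum>p<n. \<Sum>\<sigma><s. \<Sum>\<tau><t. sq (\<Sum>q<n. ?w p q \<sigma> \<tau> * z q)) \<le> L\<^sup>2 * (\<Sum>q<n. sq (z q))"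
    using * by linarith
qed

definition amplification_norms :: "nat \<Rightarrow> ((nat \<Rightarrow> complex) \<Rightarrow> nat \<Rightarrow> nat \<Rightarrow> nat \<Rightarrow> complex) \<Rightarrow> real set" where
  "amplification_norms n \<Phi> = {coln ({..<m} \<times> {..<n}) ({..<m} \<times> {..<n}) (amplification \<Phi> r) | m r.
     0 < m \<and> (\<forall>i<m. \<forall>j<m. r i j \<in> ell2) \<and> rown {..<m} {..<m} r \<le> 1}"

lemma cbn_RC_eq: "cbn_RC n \<Phi> = Sup (amplification_norms n \<Phi>)"
  unfolding cbn_RC_def amplification_norms_def amplification_def ..

lemma amplification_norms_column:
  assumes "orthonormal s f"
  shows "coln ({..<Suc s} \<times> {..<n}) ({..<Suc s} \<times> {..<n}) (amplification \<Phi> (column s f)) \<in> amplification_norms n \<Phi>"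
  unfolding amplification_norms_def using column_ell2[OF assms] rown_column_le[OF assms] by blast

lemma
  fixes u :: "nat \<Rightarrow> nat \<Rightarrow> ('x::finite \<times> 'y::finite) \<Rightarrow> ('a::finite \<times> 'b::finite) \<Rightarrow> complex"
  shows wcb_norm_nonneg: "0 \<le> wcb_norm n u"
    and wcb_norm_le_iff: "0 \<le> L \<Longrightarrow> wcb_norm n u \<le> L \<longleftrightarrow> iso_bnd n u L"
proof -
  let ?\<Phi> = "\<lambda>\<alpha> \<beta> \<xi> p q. \<beta> (omega_map u (\<alpha> \<xi>) p q)"
  let ?S = "{cbn_RC n (?\<Phi> \<alpha> \<beta>) | (\<alpha> :: (nat \<Rightarrow> complex) \<Rightarrow> 'a \<Rightarrow> 'x \<Rightarrow> complex)
    (\<beta> :: ('y \<Rightarrow> 'b \<Rightarrow> complex) \<Rightarrow> nat \<Rightarrow> complex). row_cc \<alpha> \<and> col_cc \<beta>}"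
  have amp_le: "x \<le> L" if "0 \<le> L" "iso_bnd n u L" "row_cc \<alpha>" "col_cc \<beta>" "x \<in> amplification_norms n (?\<Phi> \<alpha> \<beta>)"
    for x L and \<alpha> :: "(nat \<Rightarrow> complex) \<Rightarrow> 'a \<Rightarrow> 'x \<Rightarrow> complex" and \<beta> :: "('y \<Rightarrow> 'b \<Rightarrow> complex) \<Rightarrow> nat \<Rightarrow> complex"
    using that coln_amplification_le[OF that(1-4)] unfolding amplification_norms_def by auto
  have amp_ne: "amplification_norms n \<Phi> \<noteq> {}" for \<Phi>
    using amplification_norms_column[OF standard_basis_orthonormal] by blast
  have cbn_le: "cbn_RC n (?\<Phi> \<alpha> \<beta>) \<le> L" if "0 \<le> L" "iso_bnd n u L" "row_cc \<alpha>" "col_cc \<beta>"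
    for L and \<alpha> :: "(nat \<Rightarrow> complex) \<Rightarrow> 'a \<Rightarrow> 'x \<Rightarrow> complex" and \<beta> :: "('y \<Rightarrow> 'b \<Rightarrow> complex) \<Rightarrow> nat \<Rightarrow> complex"
    unfolding cbn_RC_eq by (rule cSup_least[OF amp_ne]) (rule amp_le[OF that])
  \<comment> \<open>One bound makes both nested suprema proper.\<close>
  obtain L0 where L0: "0 \<le> L0" "iso_bnd n u L0" using iso_bnd_exists by blast
  have upper: "x \<le> wcb_norm n u" if "row_cc \<alpha>" "col_cc \<beta>" "x \<in> amplification_norms n (?\<Phi> \<alpha> \<beta>)"
    for x and \<alpha> :: "(nat \<Rightarrow> complex) \<Rightarrow> 'a \<Rightarrow> 'x \<Rightarrow> complex" and \<beta> :: "('y \<Rightarrow> 'b \<Rightarrow> complex) \<Rightarrow> nat \<Rightarrow> complex"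
  proof -
    have "x \<le> cbn_RC n (?\<Phi> \<alpha> \<beta>)" unfolding cbn_RC_eq
      by (rule cSup_upper[OF that(3)]) (rule bdd_aboveI, rule amp_le[OF L0 that(1,2)])
    also have "\<dots> \<le> wcb_norm n u" unfolding wcb_norm_def
    proof (rule cSup_upper)
      show "cbn_RC n (?\<Phi> \<alpha> \<beta>) \<in> ?S" using that(1,2) by blast
      show "bdd_above ?S"
      proof (rule bdd_aboveI)
        fix y assume "y \<in> ?S"
        then show "y \<le> L0" using cbn_le[OF L0] by auto
      qed
    qed
    finally show ?thesis .
  qed
  \<comment> \<open>The zero maps form an admissible pair, which shows that the set of values is
    non-empty and its supremum non-negative.\<close>
  have z: "contr 0 (\<lambda>a x k. 0)" by (simp add: contr_def sum_nonneg)
  note rz = row_cc_of_contr[OF z] and cz = col_cc_of_contr[OF z]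
  show "0 \<le> wcb_norm n u"
  proof (rule order_trans)
    let ?\<alpha> = "\<lambda>\<xi> (a :: 'a) (x :: 'x). \<Sum>k<0::nat. \<xi> k * 0 :: complex"
    let ?\<beta> = "\<lambda>(S :: 'y \<Rightarrow> 'b \<Rightarrow> complex) k. if k < (0::nat) then \<Sum>y\<in>UNIV. \<Sum>b\<in>UNIV. S y b * 0 else 0 :: complex"
    let ?f = "\<lambda>l k::nat. if k = (l::nat) then 1 else 0 :: complex"
    show "coln ({..<Suc 0} \<times> {..<n}) ({..<Suc 0} \<times> {..<n}) (amplification (?\<Phi> ?\<alpha> ?\<beta>) (column 0 ?f)) \<le> wcb_norm n u"
      by (rule upper[OF rz cz]) (rule amplification_norms_column[OF standard_basis_orthonormal])
    show "0 \<le> coln ({..<Suc 0} \<times> {..<n}) ({..<Suc 0} \<times> {..<n}) (amplification (?\<Phi> ?\<alpha> ?\<beta>) (column 0 ?f))"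
      by (rule coln_nonneg) (auto simp: amplification_def ell2_zero)
  qed
  show "wcb_norm n u \<le> L \<longleftrightarrow> iso_bnd n u L" if L: "0 \<le> L"
  proof
    assume le: "wcb_norm n u \<le> L"
    show "iso_bnd n u L" unfolding iso_bnd_def
    proof (intro allI impI)
      fix s t and U :: "'a \<Rightarrow> 'x \<Rightarrow> nat \<Rightarrow> complex" and V :: "'b \<Rightarrow> 'y \<Rightarrow> nat \<Rightarrow> complex"
      assume "iso_ent s U" "iso_ent t V"
      note U = row_cc_of_contr[OF iso_ent_imp_contr[OF this(1)]]
        and V = col_cc_of_contr[OF iso_ent_imp_contr[OF this(2)]]
      show "bnd n u L s U t V"
        by (rule bnd_of_coln_amplification[OF L refl refl])
          (rule order_trans[OF upper[OF U V amplification_norms_column[OF standard_basis_orthonormal]] le])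
    qed
  next
    assume "iso_bnd n u L"
    then have "\<And>x. x \<in> ?S \<Longrightarrow> x \<le> L" using cbn_le[OF L] by auto
    moreover have "?S \<noteq> {}" using rz cz by blast
    ultimately show "wcb_norm n u \<le> L" unfolding wcb_norm_def by (intro cSup_least) auto
  qed
qed

theorem theorem5p4:
  fixes u :: "nat \<Rightarrow> nat \<Rightarrow> ('x::finite \<times> 'y::finite) \<Rightarrow> ('a::finite \<times> 'b::finite) \<Rightarrow> complex"
    and n :: nat
  assumes "0 < n"
  shows "loc_norm n u = wcb_norm n u"
proof (rule antisym)
  \<comment> \<open>Each norm, being non-negative, may itself serve as \<open>L\<close> in both
    criteria.\<close>
  show "loc_norm n u \<le> wcb_norm n u"
    using wcb_norm_le_iff[OF wcb_norm_nonneg] loc_norm_le_iff[OF wcb_norm_nonneg] by blast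
  show "wcb_norm n u \<le> loc_norm n u"
    using wcb_norm_le_iff[OF loc_norm_nonneg] loc_norm_le_iff[OF loc_norm_nonneg] by blast
qed

end
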